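(* Let $\mathcal C$ be a second-countable continuous field of Hilbert–Hadamard spaces. If $\mathcal C$ is locally trivial and all fibers $\mathcal C_z$ ($z\in\underline{\mathcal C}$) are isometric to the same Hilbert–Hadamard space, then its randomization $\mathcal C^{[0,1]}$ is trivial.
   Context: **Hilbert–Hadamard spaces.** A Hilbert–Hadamard space (HHS) is a complete geodesic CAT(0) space all of whose tangent cones (Euclidean cones over the completed spaces of directions with the angle metric) embed isometrically in Hilbert spaces. **Continuous fields.** A continuous field $\mathcal C$ of HHSs consists of a locally compact paracompact Hausdorff base space $\underline{\mathcal C}$, HHSs $(\mathcal C_z)_{z\in\underline{\mathcal C}}$, and a set $\Gamma_{\rm cont}(\mathcal C)\subseteq\prod_z\mathcal C_z$ of continuous sections that is: (i) closed under pointwise midpoints of two sections; (ii) pointwise dense in each fiber; (iii) mutually co-continuous: $z\mapsto d_{\mathcal C_z}(s(z),s'(z))$ is continuous for any two members ("$s,s'$ are co-continuous"); (iv) any $s\in\prod_z\mathcal C_z$ co-continuous with all members is a member. It is second-countable if $\underline{\mathcal C}$ and all fibers are. If $\Sigma\subseteq\prod_{z\in Z}X_z$ ($Z$ locally compact paracompact Hausdorff, $X_z$ HHSs) satisfies (i) and (iii), the field generated by $\Sigma$ has base $Z$, fibers $\overline{\{s(z):s\in\Sigma\}}$, and continuous sections all sections co-continuous with every element of $\Sigma$. For a continuous map $f\colon Y\to\underline{\mathcal C}$, the pullback $f^*\mathcal C$ (written $\mathcal C|_Y$ when $f$ is an inclusion $Y\subseteq\underline{\mathcal C}$ or a projection $Y=\underline{\mathcal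 C}\times Z\to\underline{\mathcal C}$) has fibers $\mathcal C_{f(y)}$ and is generated by $\{s\circ f:s\in\Gamma_{\rm cont}(\mathcal C)\}$. **Triviality.** An isometric continuous isomorphism $\varphi\colon\mathcal C\to\mathcal D$ consists of a homeomorphism $\underline\varphi\colon\underline{\mathcal D}\to\underline{\mathcal C}$ and isometric bijections $\varphi_y\colon\mathcal C_{\underline\varphi(y)}\to\mathcal D_y$ such that $(\varphi_y(s(\underline\varphi(y))))_y\in\Gamma_{\rm cont}(\mathcal D)$ for each $s\in\Gamma_{\rm cont}(\mathcal C)$. The constant field $(X)_Z$ has all fibers $X$ and continuous sections $C(Z,X)$. A field is trivial if isometrically continuously isomorphic to a constant field, and locally trivial if every $z\in\underline{\mathcal C}$ has an open neighborhood $U$ with $\mathcal C|_U$ trivial. **Randomization.** Let $m$ be Lebesgue measure on $[0,1]$ and $L^2([0,1],m,X)$ the HHS of a.e.-classes of measurable $\xi\colon[0,1]\to X$ with $\int d(\xi,x_0)^2dm<\infty$ (some/any $x_0\in X$), with metric $(\int d(\xi,\eta)^2dm)^{1/2}$. For second-countable $\mathcal C$, the randomization $\mathcal C^{[0,1]}$ is the field over $\underline{\mathcal C}$ with fibers $L^2([0,1],m,\mathcal C_z)$ generated by the sections $z\mapsto(t\mapsto s(z,t))$, $s\in\Gamma_{\rm cont}(\mathcal C|_{\underline{\mathcal C}\times[0,1]})$. *)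

theory Defs
  imports "HOL-Analysis.Analysis"
begin

section \<open>Quotients of pseudometric spaces\<close>

text \<open>The library's type of metric spaces requires the distance function to be nonnegative and
  symmetric on the whole type, and \<open>metric (M, d)\<close> is unspecified otherwise. Distances
  that are meaningful only on the carrier are therefore set to \<open>0\<close> outside of it.\<close>

definition quotient_metric ::
    "'a set \<Rightarrow> ('a \<times> 'a) set \<Rightarrow> ('a \<Rightarrow> 'a \<Rightarrow> real) \<Rightarrow> 'a set metric" where
  "quotient_metric A R d =
     metric (A // R, \<lambda>P Q. if P \<in> A // R \<and> Q \<in> A // R
                            then d (SOME x. x \<in> P) (SOME y. y \<in> Q) else 0)"

definition metric_identification :: "'a set \<Rightarrow> ('a \<Rightarrow> 'a \<Rightarrow> real) \<Rightarrow> 'a set metric" where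
  "metric_identification A d = quotient_metric A {(x, y). x \<in> A \<and> y \<in> A \<and> d x y = 0} d"

locale pseudometric_on =
  fixes A :: "'a set" and d :: "'a \<Rightarrow> 'a \<Rightarrow> real"
  assumes nonneg: "\<lbrakk>x \<in> A; y \<in> A\<rbrakk> \<Longrightarrow> 0 \<le> d x y"
    and refl: "x \<in> A \<Longrightarrow> d x x = 0"
    and commute: "\<lbrakk>x \<in> A; y \<in> A\<rbrakk> \<Longrightarrow> d x y = d y x"
    and triangle: "\<lbrakk>x \<in> A; y \<in> A; z \<in> A\<rbrakk> \<Longrightarrow> d x z \<le> d x y + d y z"
begin

definition "zero_rel = {(x, y). x \<in> A \<and> y \<in> A \<and> d x y = 0}"

lemma equiv_zero_rel: "equiv A zero_rel"
proof (rule equivI)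
  show "refl_on A zero_rel" by (auto simp: refl_on_def zero_rel_def refl)
  show "zero_rel \<subseteq> A \<times> A" by (auto simp: zero_rel_def)
  show "sym zero_rel" by (auto simp: sym_def zero_rel_def commute)
  show "trans zero_rel"
  proof (rule transI)
    fix x y z assume "(x, y) \<in> zero_rel" "(y, z) \<in> zero_rel"
    then show "(x, z) \<in> zero_rel"
      using nonneg[of x z] triangle[of x y z] by (simp add: zero_rel_def)
  qed
qed

lemma d_zero_rel_cong:
  assumes "(x, x') \<in> zero_rel" "(y, y') \<in> zero_rel"
  shows "d x y = d x' y'"
proof -
  have "x \<in> A" "x' \<in> A" "y \<in> A" "y' \<in> A" "d x x' = 0" "d y y' = 0"
    using assms by (auto simp: zero_rel_def)
  then show ?thesis
    using triangle[of x x' y] triangle[of x' y' y] triangle[of x' x y'] triangle[of x y y']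
      commute[of x x'] commute[of y y'] by auto
qed

lemma some_in_class: "P \<in> A // zero_rel \<Longrightarrow> (SOME x. x \<in> P) \<in> P \<and> (SOME x. x \<in> P) \<in> A"
  by (metis equiv_zero_rel in_quotient_imp_non_empty in_quotient_imp_subset some_in_eq subsetD)

lemma Metric_space_quotient:
  "Metric_space (A // zero_rel)
     (\<lambda>P Q. if P \<in> A // zero_rel \<and> Q \<in> A // zero_rel
             then d (SOME x. x \<in> P) (SOME y. y \<in> Q) else 0)"
proof
  fix P Q assume PQ: "P \<in> A // zero_rel" "Q \<in> A // zero_rel"
  have "d (SOME x. x \<in> P) (SOME y. y \<in> Q) = 0 \<longleftrightarrow>
        ((SOME x. x \<in> P), (SOME y. y \<in> Q)) \<in> zero_rel"
    using some_in_class PQ by (simp add: zero_rel_def)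
  also have "\<dots> \<longleftrightarrow> P = Q"
    using quotient_eq_iff[OF equiv_zero_rel PQ] some_in_class PQ by blast
  finally show "(if P \<in> A // zero_rel \<and> Q \<in> A // zero_rel
                 then d (SOME x. x \<in> P) (SOME y. y \<in> Q) else 0) = 0 \<longleftrightarrow> P = Q"
    using PQ by simp
qed (use some_in_class in \<open>auto intro: nonneg commute triangle\<close>)

lemma
  assumes "R = zero_rel"
  shows mspace_quotient_metric: "mspace (quotient_metric A R d) = A // R"
    and mdist_quotient_metric:
      "\<lbrakk>x \<in> A; y \<in> A\<rbrakk> \<Longrightarrow> mdist (quotient_metric A R d) (R `` {x}) (R `` {y}) = d x y"
proof -
  interpret Q: Metric_space "A // zero_rel"
      "\<lambda>P Q. if P \<in> A // zero_rel \<and> Q \<in> A // zero_rel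
             then d (SOME x. x \<in> P) (SOME y. y \<in> Q) else 0"
    by (rule Metric_space_quotient)
  show "mspace (quotient_metric A R d) = A // R"
    by (simp add: quotient_metric_def assms)
  assume xy: "x \<in> A" "y \<in> A"
  then have cl: "zero_rel `` {x} \<in> A // zero_rel" "zero_rel `` {y} \<in> A // zero_rel"
    by (auto simp: quotientI)
  have "d (SOME u. u \<in> zero_rel `` {x}) (SOME v. v \<in> zero_rel `` {y}) = d x y"
    using some_in_class[OF cl(1)] some_in_class[OF cl(2)]
    by (metis d_zero_rel_cong Image_singleton_iff)
  then show "mdist (quotient_metric A R d) (R `` {x}) (R `` {y}) = d x y"
    using cl by (simp add: quotient_metric_def assms)
qed

end


section \<open>Hilbert--Hadamard spaces\<close>

text \<open>A geodesic from \<open>x\<close> to \<open>y\<close>, parametrized proportionally to arc length on \<open>[0,1]\<close>.\<close>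

definition geodesic_path :: "'a metric \<Rightarrow> 'a \<Rightarrow> 'a \<Rightarrow> (real \<Rightarrow> 'a) \<Rightarrow> bool" where
  "geodesic_path X x y \<gamma> \<longleftrightarrow>
     \<gamma> \<in> {0..1} \<rightarrow> mspace X \<and> \<gamma> 0 = x \<and> \<gamma> 1 = y \<and>
     (\<forall>s\<in>{0..1}. \<forall>t\<in>{0..1}. mdist X (\<gamma> s) (\<gamma> t) = \<bar>s - t\<bar> * mdist X x y)"

definition geodesic_space :: "'a metric \<Rightarrow> bool" where
  "geodesic_space X \<longleftrightarrow> (\<forall>x\<in>mspace X. \<forall>y\<in>mspace X. \<exists>\<gamma>. geodesic_path X x y \<gamma>)"

text \<open>In a geodesic triangle with vertices \<open>p, q, r\<close> and comparison triangle
  \<open>p', q', r'\<close> in the Euclidean plane, any two sides share a vertex; naming that vertex \<open>p\<close>,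
  distances between points on the two sides are compared with those between the corresponding
  points of the comparison triangle.\<close>

definition CAT0 :: "'a metric \<Rightarrow> bool" where
  "CAT0 X \<longleftrightarrow>
     (\<forall>p q r \<gamma> \<delta>. \<forall>p' q' r' :: real^2.
        p \<in> mspace X \<and> q \<in> mspace X \<and> r \<in> mspace X \<and>
        geodesic_path X p q \<gamma> \<and> geodesic_path X p r \<delta> \<and>
        dist p' q' = mdist X p q \<and> dist p' r' = mdist X p r \<and> dist q' r' = mdist X q r \<longrightarrow>
        (\<forall>s\<in>{0..1}. \<forall>t\<in>{0..1}.
           mdist X (\<gamma> s) (\<delta> t)
             \<le> dist ((1 - s) *\<^sub>R p' + s *\<^sub>R q') ((1 - t) *\<^sub>R p' + t *\<^sub>R r')))"

definition comparison_angle :: "'a metric \<Rightarrow> 'a \<Rightarrow> 'a \<Rightarrow> 'a \<Rightarrow> real" where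
  "comparison_angle X p x y =
     arccos (((mdist X p x)\<^sup>2 + (mdist X p y)\<^sup>2 - (mdist X x y)\<^sup>2) / (2 * mdist X p x * mdist X p y))"

definition alexandrov_angle :: "'a metric \<Rightarrow> 'a \<Rightarrow> (real \<Rightarrow> 'a) \<Rightarrow> (real \<Rightarrow> 'a) \<Rightarrow> real" where
  "alexandrov_angle X p \<gamma> \<delta> =
     real_of_ereal (Limsup (at_right 0 \<times>\<^sub>F at_right 0)
       (\<lambda>(s, t). ereal (comparison_angle X p (\<gamma> s) (\<delta> t))))"

text \<open>Two nontrivial geodesics issuing from \<open>p\<close> have the same direction if their angle is \<open>0\<close>.\<close>

definition space_of_directions :: "'a metric \<Rightarrow> 'a \<Rightarrow> (real \<Rightarrow> 'a) set metric" where
  "space_of_directions X p =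
     metric_identification {\<gamma>. \<exists>x\<in>mspace X. x \<noteq> p \<and> geodesic_path X p x \<gamma>} (alexandrov_angle X p)"

definition completion :: "'a metric \<Rightarrow> (nat \<Rightarrow> 'a) set metric" where
  "completion X =
     metric_identification {\<sigma>. Metric_space.MCauchy (mspace X) (mdist X) \<sigma>}
       (\<lambda>\<sigma> \<tau>. lim (\<lambda>n. mdist X (\<sigma> n) (\<tau> n)))"

text \<open>The law of cosines makes the distance between \<open>(a, x)\<close> and \<open>(b, y)\<close> zero exactly if
  these pairs are equal or \<open>a = b = 0\<close>, so that the identification produces the apex.
  (For an empty \<open>Y\<close> the cone is empty here rather than just the apex, which makes no difference to
  its embeddability in Hilbert spaces.)\<close>

definition euclidean_cone :: "'a metric \<Rightarrow> (real \<times> 'a) set metric" where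
  "euclidean_cone Y =
     metric_identification ({0..} \<times> mspace Y)
       (\<lambda>(a, x) (b, y). sqrt (a\<^sup>2 + b\<^sup>2 - 2 * a * b * cos (min pi (mdist Y x y))))"

definition tangent_cone ::
    "'a metric \<Rightarrow> 'a \<Rightarrow> (real \<times> (nat \<Rightarrow> (real \<Rightarrow> 'a) set) set) set metric" where
  "tangent_cone X p = euclidean_cone (completion (space_of_directions X p))"

definition ell2 :: "'i set \<Rightarrow> ('i \<Rightarrow> real) metric" where
  "ell2 I =
     metric ({x. (\<forall>i. i \<notin> I \<longrightarrow> x i = 0) \<and> (\<lambda>i. (x i)\<^sup>2) summable_on I},
             \<lambda>x y. sqrt (\<Sum>\<^sub>\<infinity>i\<in>I. (x i - y i)\<^sup>2))"

text \<open>Every Hilbert space is isometric to some \<open>\<ell>\<^sup>2(I)\<close>. A subset \<open>T\<close> of a Hilbert space lies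
  in the translate by one of its points of the closed span of the differences of its points, which
  has an orthonormal basis of cardinality at most that of \<open>T\<close>. So index sets \<open>I\<close> within the type
  of the points of the metric space suffice.\<close>

definition hilbert_embeddable :: "'a metric \<Rightarrow> bool" where
  "hilbert_embeddable X \<longleftrightarrow>
     (\<exists>(I :: 'a set) f. f \<in> mspace X \<rightarrow> mspace (ell2 I) \<and>
        (\<forall>x\<in>mspace X. \<forall>y\<in>mspace X. mdist (ell2 I) (f x) (f y) = mdist X x y))"

definition hilbert_hadamard :: "'a metric \<Rightarrow> bool" where
  "hilbert_hadamard X \<longleftrightarrow>
     mspace X \<noteq> {} \<and> Metric_space.mcomplete (mspace X) (mdist X) \<and> geodesic_space X \<and> CAT0 X \<and>
     (\<forall>p\<in>mspace X. hilbert_embeddable (tangent_cone X p))"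


section \<open>Continuous fields\<close>

definition paracompact_space :: "'a topology \<Rightarrow> bool" where
  "paracompact_space Z \<longleftrightarrow>
     (\<forall>\<U>. (\<forall>U\<in>\<U>. openin Z U) \<and> topspace Z \<subseteq> \<Union>\<U> \<longrightarrow>
        (\<exists>\<V>. (\<forall>V\<in>\<V>. openin Z V \<and> (\<exists>U\<in>\<U>. V \<subseteq> U)) \<and> topspace Z \<subseteq> \<Union>\<V> \<and> locally_finite_in Z \<V>))"

text \<open>All fibers are carried by subsets of one type, as can always be arranged by a
  disjoint union. Only the fibers over points of the base matter, and sections are extensional
  functions on the base.\<close>

record ('z, 'a) metric_field =
  base :: "'z topology"
  fiber :: "'z \<Rightarrow> 'a metric"
  cont_sections :: "('z \<Rightarrow> 'a) set"

definition all_sections :: "'z topology \<Rightarrow> ('z \<Rightarrow> 'a metric) \<Rightarrow> ('z \<Rightarrow> 'a) set" where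
  "all_sections Z X = (\<Pi>\<^sub>E z\<in>topspace Z. mspace (X z))"

definition co_continuous ::
    "'z topology \<Rightarrow> ('z \<Rightarrow> 'a metric) \<Rightarrow> ('z \<Rightarrow> 'a) \<Rightarrow> ('z \<Rightarrow> 'a) \<Rightarrow> bool" where
  "co_continuous Z X s s' \<longleftrightarrow> continuous_map Z euclideanreal (\<lambda>z. mdist (X z) (s z) (s' z))"

definition is_midpoint :: "'a metric \<Rightarrow> 'a \<Rightarrow> 'a \<Rightarrow> 'a \<Rightarrow> bool" where
  "is_midpoint X x y m \<longleftrightarrow> mdist X x m = mdist X x y / 2 \<and> mdist X m y = mdist X x y / 2"

definition continuous_field :: "('z, 'a) metric_field \<Rightarrow> bool" where
  "continuous_field C \<longleftrightarrow>
     locally_compact_space (base C) \<and> paracompact_space (base C) \<and> Hausdorff_space (base C) \<and>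
     (\<forall>z\<in>topspace (base C). hilbert_hadamard (fiber C z)) \<and>
     cont_sections C \<subseteq> all_sections (base C) (fiber C) \<and>
     (\<forall>s\<in>cont_sections C. \<forall>s'\<in>cont_sections C. \<forall>m\<in>all_sections (base C) (fiber C).
        (\<forall>z\<in>topspace (base C). is_midpoint (fiber C z) (s z) (s' z) (m z)) \<longrightarrow> m \<in> cont_sections C) \<and>
     (\<forall>z\<in>topspace (base C).
        mtopology_of (fiber C z) closure_of ((\<lambda>s. s z) ` cont_sections C) = mspace (fiber C z)) \<and>
     (\<forall>s\<in>cont_sections C. \<forall>s'\<in>cont_sections C. co_continuous (base C) (fiber C) s s') \<and>
     (\<forall>s\<in>all_sections (base C) (fiber C).
        (\<forall>s'\<in>cont_sections C. co_continuous (base C) (fiber C) s s') \<longrightarrow> s \<in> cont_sections C)"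

definition second_countable_field :: "('z, 'a) metric_field \<Rightarrow> bool" where
  "second_countable_field C \<longleftrightarrow>
     second_countable (base C) \<and>
     (\<forall>z\<in>topspace (base C). second_countable (mtopology_of (fiber C z)))"

definition generated_field ::
    "'z topology \<Rightarrow> ('z \<Rightarrow> 'a metric) \<Rightarrow> ('z \<Rightarrow> 'a) set \<Rightarrow> ('z, 'a) metric_field" where
  "generated_field Z X \<Sigma> =
     (let F = (\<lambda>z. submetric (X z) (mtopology_of (X z) closure_of ((\<lambda>s. s z) ` \<Sigma>)))
      in \<lparr>base = Z, fiber = F,
          cont_sections = {s \<in> all_sections Z F. \<forall>s'\<in>\<Sigma>. co_continuous Z X s s'}\<rparr>)"

definition pullback_field ::
    "'y topology \<Rightarrow> ('y \<Rightarrow> 'z) \<Rightarrow> ('z, 'a) metric_field \<Rightarrow> ('y, 'a) metric_field" where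
  "pullback_field Y f C =
     generated_field Y (\<lambda>y. fiber C (f y))
       ((\<lambda>s. restrict (s \<circ> f) (topspace Y)) ` cont_sections C)"

definition restrict_field :: "('z, 'a) metric_field \<Rightarrow> 'z set \<Rightarrow> ('z, 'a) metric_field" where
  "restrict_field C U = pullback_field (subtopology (base C) U) (\<lambda>z. z) C"


section \<open>Triviality\<close>

definition isometric_bij :: "'a metric \<Rightarrow> 'b metric \<Rightarrow> ('a \<Rightarrow> 'b) \<Rightarrow> bool" where
  "isometric_bij X Y f \<longleftrightarrow>
     bij_betw f (mspace X) (mspace Y) \<and>
     (\<forall>x\<in>mspace X. \<forall>x'\<in>mspace X. mdist Y (f x) (f x') = mdist X x x')"

definition isometric_field_iso ::
    "('z, 'a) metric_field \<Rightarrow> ('y, 'b) metric_field \<Rightarrow> ('y \<Rightarrow> 'z) \<Rightarrow> ('y \<Rightarrow> 'a \<Rightarrow> 'b) \<Rightarrow> bool" where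
  "isometric_field_iso C D g \<phi> \<longleftrightarrow>
     homeomorphic_map (base D) (base C) g \<and>
     (\<forall>y\<in>topspace (base D). isometric_bij (fiber C (g y)) (fiber D y) (\<phi> y)) \<and>
     (\<forall>s\<in>cont_sections C. (\<lambda>y\<in>topspace (base D). \<phi> y (s (g y))) \<in> cont_sections D)"

definition constant_field :: "'z topology \<Rightarrow> 'a metric \<Rightarrow> ('z, 'a) metric_field" where
  "constant_field Z X =
     \<lparr>base = Z, fiber = (\<lambda>_. X),
      cont_sections = {s \<in> all_sections Z (\<lambda>_. X). continuous_map Z (mtopology_of X) s}\<rparr>"

text \<open>\<open>Z\<close> and \<open>X\<close> are homeomorphic to the base and isometric to the fibers of \<open>C\<close>, so there is no
  loss in taking them over the same types. In particular \<open>X\<close> is a Hilbert--Hadamard space if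
  the fibers of \<open>C\<close> are (and can be chosen to be one if the base is empty).\<close>

definition trivial_field :: "('z, 'a) metric_field \<Rightarrow> bool" where
  "trivial_field C \<longleftrightarrow>
     (\<exists>(Z :: 'z topology) (X :: 'a metric) g \<phi>. isometric_field_iso C (constant_field Z X) g \<phi>)"

definition locally_trivial_field :: "('z, 'a) metric_field \<Rightarrow> bool" where
  "locally_trivial_field C \<longleftrightarrow>
     (\<forall>z\<in>topspace (base C). \<exists>U. openin (base C) U \<and> z \<in> U \<and> trivial_field (restrict_field C U))"


section \<open>Randomization\<close>

abbreviation unit_lebesgue :: "real measure" where
  "unit_lebesgue \<equiv> lebesgue_on {0..1}"

definition metric_borel :: "'a metric \<Rightarrow> 'a measure" where
  "metric_borel X = sigma (mspace X) {U. openin (mtopology_of X) U}"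

definition L2_functions :: "'a metric \<Rightarrow> (real \<Rightarrow> 'a) set" where
  "L2_functions X =
     {\<xi> \<in> measurable unit_lebesgue (metric_borel X).
        \<exists>x0\<in>mspace X. integrable unit_lebesgue (\<lambda>t. (mdist X (\<xi> t) x0)\<^sup>2)}"

definition ae_equal :: "'a metric \<Rightarrow> ((real \<Rightarrow> 'a) \<times> (real \<Rightarrow> 'a)) set" where
  "ae_equal X =
     {(\<xi>, \<eta>). \<xi> \<in> L2_functions X \<and> \<eta> \<in> L2_functions X \<and> (AE t in unit_lebesgue. \<xi> t = \<eta> t)}"

definition L2_dist :: "'a metric \<Rightarrow> (real \<Rightarrow> 'a) \<Rightarrow> (real \<Rightarrow> 'a) \<Rightarrow> real" where
  "L2_dist X \<xi> \<eta> = sqrt (LINT t|unit_lebesgue. (mdist X (\<xi> t) (\<eta> t))\<^sup>2)"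

definition L2_space :: "'a metric \<Rightarrow> (real \<Rightarrow> 'a) set metric" where
  "L2_space X = quotient_metric (L2_functions X) (ae_equal X) (L2_dist X)"

text \<open>The \<open>L\<^sup>2\<close>-distance is a pseudometric whose zero relation is equality almost everywhere.
  Separability makes the distance of two measurable functions measurable.\<close>

lemma space_metric_borel [simp]: "space (metric_borel X) = mspace X"
  unfolding metric_borel_def
  by (rule space_measure_of) (metis (mono_tags, lifting) Pow_iff mem_Collect_eq openin_subset subsetI topspace_mtopology_of)

lemma sets_metric_borel: "sets (metric_borel X) = sigma_sets (mspace X) {U. openin (mtopology_of X) U}"
  unfolding metric_borel_def
  by (rule sets_measure_of) (metis (mono_tags, lifting) Pow_iff mem_Collect_eq openin_subset subsetI topspace_mtopology_of)

lemma measurable_mdist_const [measurable]: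
  assumes "c \<in> mspace X"
  shows "(\<lambda>x. mdist X x c) \<in> borel_measurable (metric_borel X)"
proof (rule borel_measurableI_less)
  fix y :: real
  interpret Metric_space "mspace X" "mdist X" by simp
  have "{x \<in> mspace X. mdist X x c < y} = mball c y"
    using assms by (auto simp: commute)
  then have "openin (mtopology_of X) {x \<in> mspace X. mdist X x c < y}"
    by (simp add: mtopology_of_def)
  then show "{x \<in> space (metric_borel X). mdist X x c < y} \<in> sets (metric_borel X)"
    by (auto simp: sets_metric_borel)
qed

lemma countable_dense_mspace:
  assumes "second_countable (mtopology_of X)"
  obtains D where "countable D" "D \<subseteq> mspace X"
    "\<And>x e. x \<in> mspace X \<Longrightarrow> e > 0 \<Longrightarrow> \<exists>c\<in>D. mdist X x c < e"
proof -
  interpret Metric_space "mspace X" "mdist X" by simp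
  obtain \<B> where \<B>: "countable \<B>" "\<And>V. V \<in> \<B> \<Longrightarrow> openin (mtopology_of X) V"
    "\<And>U x. openin (mtopology_of X) U \<Longrightarrow> x \<in> U \<Longrightarrow> \<exists>V\<in>\<B>. x \<in> V \<and> V \<subseteq> U"
    using assms unfolding second_countable_def by metis
  define D where "D = (\<lambda>V. SOME x. x \<in> V) ` (\<B> - {{}})"
  show thesis
  proof
    show "countable D" by (simp add: D_def \<B>(1))
    show "D \<subseteq> mspace X"
    proof
      fix x assume "x \<in> D"
      then obtain V where V: "V \<in> \<B>" "V \<noteq> {}" "x = (SOME x. x \<in> V)" by (auto simp: D_def)
      then have "x \<in> V" using some_in_eq[of V] by simp
      then show "x \<in> mspace X" using openin_subset[OF \<B>(2)[OF V(1)]] by auto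
    qed
    fix x e assume x: "x \<in> mspace X" "(e::real) > 0"
    have "openin (mtopology_of X) (mball x e)" "x \<in> mball x e"
      using x by (auto simp: mtopology_of_def)
    then obtain V where V: "V \<in> \<B>" "x \<in> V" "V \<subseteq> mball x e" using \<B>(3) by blast
    then have "V \<noteq> {}" by auto
    moreover define c where "c = (SOME y. y \<in> V)"
    ultimately have "c \<in> D" "c \<in> V"
      using V(1) some_in_eq[of V] by (auto simp: D_def)
    moreover from this have "c \<in> mball x e" using V(3) by blast
    ultimately show "\<exists>c\<in>D. mdist X x c < e" by auto
  qed
qed

lemma measurable_mdist:
  assumes "second_countable (mtopology_of X)"
    and [measurable]: "\<xi> \<in> measurable M (metric_borel X)" "\<eta> \<in> measurable M (metric_borel X)"
  shows "(\<lambda>t. mdist X (\<xi> t) (\<eta> t)) \<in> borel_measurable M"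
proof (rule borel_measurableI_less)
  fix y :: real
  obtain D where D: "countable D" "D \<subseteq> mspace X"
    "\<And>x e. x \<in> mspace X \<Longrightarrow> e > 0 \<Longrightarrow> \<exists>c\<in>D. mdist X x c < e"
    by (rule countable_dense_mspace[OF assms(1)]) blast
  have sp: "\<xi> t \<in> mspace X" "\<eta> t \<in> mspace X" if "t \<in> space M" for t
    using that assms(2,3)[THEN measurable_space] by auto
  have *: "mdist X (\<xi> t) (\<eta> t) < y \<longleftrightarrow> (\<exists>c\<in>D. mdist X (\<xi> t) c + mdist X (\<eta> t) c < y)"
    if t: "t \<in> space M" for t
  proof
    assume "mdist X (\<xi> t) (\<eta> t) < y"
    then obtain c where c: "c \<in> D" "mdist X (\<eta> t) c < (y - mdist X (\<xi> t) (\<eta> t)) / 2"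
      using D(3)[of "\<eta> t" "(y - mdist X (\<xi> t) (\<eta> t)) / 2"] sp[OF t] by auto
    have "mdist X (\<xi> t) c \<le> mdist X (\<xi> t) (\<eta> t) + mdist X (\<eta> t) c"
      using mdist_triangle[of "\<xi> t" X "\<eta> t" c] sp[OF t] c(1) D(2) by auto
    then show "\<exists>c\<in>D. mdist X (\<xi> t) c + mdist X (\<eta> t) c < y"
      using c by (intro bexI[of _ c]) (auto simp: field_simps)
  next
    assume "\<exists>c\<in>D. mdist X (\<xi> t) c + mdist X (\<eta> t) c < y"
    then obtain c where "c \<in> D" "mdist X (\<xi> t) c + mdist X (\<eta> t) c < y" by blast
    then show "mdist X (\<xi> t) (\<eta> t) < y"
      using mdist_triangle[of "\<xi> t" X c "\<eta> t"] sp[OF t] D(2) mdist_commute[of X c "\<eta> t"] by auto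
  qed
  have [measurable]: "(\<lambda>t. mdist X (\<xi> t) c) \<in> borel_measurable M"
    "(\<lambda>t. mdist X (\<eta> t) c) \<in> borel_measurable M" if "c \<in> D" for c
    using D(2) that
    by (auto intro!: measurable_compose[OF assms(2)] measurable_compose[OF assms(3)]
        measurable_mdist_const)
  have "{t \<in> space M. mdist X (\<xi> t) (\<eta> t) < y}
      = (\<Union>c\<in>D. {t \<in> space M. mdist X (\<xi> t) c + mdist X (\<eta> t) c < y})"
    using * by auto
  also have "\<dots> \<in> sets M"
  proof (rule sets.countable_UN''[OF D(1)])
    fix c assume [simp]: "c \<in> D"
    show "{t \<in> space M. mdist X (\<xi> t) c + mdist X (\<eta> t) c < y} \<in> sets M" by measurable
  qed
  finally show "{t \<in> space M. mdist X (\<xi> t) (\<eta> t) < y} \<in> sets M" .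
qed

lemma sqrt_integral_triangle:
  fixes f g h :: "'t \<Rightarrow> real"
  assumes f: "integrable M (\<lambda>t. (f t)\<^sup>2)" and g: "integrable M (\<lambda>t. (g t)\<^sup>2)"
    and h: "integrable M (\<lambda>t. (h t)\<^sup>2)"
    and le: "\<And>t. t \<in> space M \<Longrightarrow> 0 \<le> h t \<and> h t \<le> f t + g t"
  shows "sqrt (LINT t|M. (h t)\<^sup>2) \<le> sqrt (LINT t|M. (f t)\<^sup>2) + sqrt (LINT t|M. (g t)\<^sup>2)"
proof -
  define a b where "a = sqrt (LINT t|M. (f t)\<^sup>2)" and "b = sqrt (LINT t|M. (g t)\<^sup>2)"
  have nn: "a \<ge> 0" "b \<ge> 0" and sq: "(LINT t|M. (f t)\<^sup>2) = a\<^sup>2" "(LINT t|M. (g t)\<^sup>2) = b\<^sup>2"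
    by (auto simp: a_def b_def)
  have young: "(LINT t|M. (h t)\<^sup>2) \<le> (1 + r) * a\<^sup>2 + (1 + 1 / r) * b\<^sup>2" if r: "r > 0" for r
  proof -
    have "(LINT t|M. (h t)\<^sup>2) \<le> (LINT t|M. (1 + r) * (f t)\<^sup>2 + (1 + 1 / r) * (g t)\<^sup>2)"
    proof (rule integral_mono)
      fix t assume t: "t \<in> space M"
      have "(h t)\<^sup>2 \<le> (f t + g t)\<^sup>2" using le[OF t] by (intro power_mono) auto
      also have "\<dots> \<le> (1 + r) * (f t)\<^sup>2 + (1 + 1 / r) * (g t)\<^sup>2"
      proof -
        have "0 \<le> (r * f t - g t)\<^sup>2 / r" using r by simp
        also have "\<dots> = r * (f t)\<^sup>2 - 2 * f t * g t + (g t)\<^sup>2 / r"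
          using r by (simp add: power2_eq_square field_simps)
        finally show ?thesis by (simp add: power2_eq_square algebra_simps)
      qed
      finally show "(h t)\<^sup>2 \<le> (1 + r) * (f t)\<^sup>2 + (1 + 1 / r) * (g t)\<^sup>2" .
    qed (use f g h in auto)
    also have "\<dots> = (1 + r) * a\<^sup>2 + (1 + 1 / r) * b\<^sup>2" using f g by (simp add: sq)
    finally show ?thesis .
  qed
  have "sqrt (LINT t|M. (h t)\<^sup>2) \<le> a + b"
  proof (rule field_le_epsilon)
    fix e :: real assume e: "e > 0"
    let ?a = "a + e / 2" and ?b = "b + e / 2"
    have pos: "?a > 0" "?b > 0" using nn e by auto
    have "(LINT t|M. (h t)\<^sup>2) \<le> (1 + ?b / ?a) * a\<^sup>2 + (1 + 1 / (?b / ?a)) * b\<^sup>2"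
      using pos by (intro young) auto
    also have "\<dots> \<le> (1 + ?b / ?a) * ?a\<^sup>2 + (1 + 1 / (?b / ?a)) * ?b\<^sup>2"
      using pos nn e by (intro add_mono mult_left_mono power_mono) auto
    also have "\<dots> = (?a + ?b)\<^sup>2"
    proof -
      have "(1 + q / p) * p\<^sup>2 + (1 + 1 / (q / p)) * q\<^sup>2 = (p + q)\<^sup>2" if "p > 0" "q > 0" for p q :: real
        using that by (simp add: power2_eq_square field_simps)
      then show ?thesis using pos by blast
    qed
    finally have "sqrt (LINT t|M. (h t)\<^sup>2) \<le> ?a + ?b"
      using pos by (intro real_le_lsqrt) auto
    then show "sqrt (LINT t|M. (h t)\<^sup>2) \<le> a + b + e" by simp
  qed
  then show ?thesis by (simp add: a_def b_def)
qed

lemma integrable_mdist_L2: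
  assumes "second_countable (mtopology_of X)" "\<xi> \<in> L2_functions X" "\<eta> \<in> L2_functions X"
  shows "integrable unit_lebesgue (\<lambda>t. (mdist X (\<xi> t) (\<eta> t))\<^sup>2)"
proof -
  obtain x y where x: "x \<in> mspace X" "integrable unit_lebesgue (\<lambda>t. (mdist X (\<xi> t) x)\<^sup>2)"
    and y: "y \<in> mspace X" "integrable unit_lebesgue (\<lambda>t. (mdist X (\<eta> t) y)\<^sup>2)"
    and meas: "\<xi> \<in> measurable unit_lebesgue (metric_borel X)"
      "\<eta> \<in> measurable unit_lebesgue (metric_borel X)"
    using assms(2,3) by (auto simp: L2_functions_def)
  have [measurable]: "(\<lambda>t. mdist X (\<xi> t) (\<eta> t)) \<in> borel_measurable unit_lebesgue"
    by (rule measurable_mdist[OF assms(1) meas])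
  interpret finite_measure unit_lebesgue
    by (rule finite_measure_lebesgue_on) auto
  show ?thesis
  proof (rule Bochner_Integration.integrable_bound)
    show "integrable unit_lebesgue (\<lambda>t. 3 * ((mdist X (\<xi> t) x)\<^sup>2 + (mdist X x y)\<^sup>2 + (mdist X (\<eta> t) y)\<^sup>2))"
      using x y by auto
    have sq: "(u + v + w)\<^sup>2 \<le> 3 * (u\<^sup>2 + v\<^sup>2 + w\<^sup>2)" for u v w :: real
      using sum_squares_bound[of u v] sum_squares_bound[of u w] sum_squares_bound[of v w]
      by (simp add: power2_eq_square algebra_simps)
    show "AE t in unit_lebesgue. norm ((mdist X (\<xi> t) (\<eta> t))\<^sup>2)
        \<le> norm (3 * ((mdist X (\<xi> t) x)\<^sup>2 + (mdist X x y)\<^sup>2 + (mdist X (\<eta> t) y)\<^sup>2))"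
    proof (rule AE_I2)
      fix t assume t: "t \<in> space unit_lebesgue"
      have sp: "\<xi> t \<in> mspace X" "\<eta> t \<in> mspace X"
        using meas[THEN measurable_space, OF t] by auto
      have "mdist X (\<xi> t) (\<eta> t) \<le> mdist X (\<xi> t) x + mdist X x y + mdist X (\<eta> t) y"
        using mdist_triangle[of "\<xi> t" X x "\<eta> t"] mdist_triangle[of x X y "\<eta> t"] sp x y
        by (simp add: mdist_commute)
      then have "(mdist X (\<xi> t) (\<eta> t))\<^sup>2 \<le> (mdist X (\<xi> t) x + mdist X x y + mdist X (\<eta> t) y)\<^sup>2"
        by (intro power_mono) auto
      also note sq
      finally show "norm ((mdist X (\<xi> t) (\<eta> t))\<^sup>2)
        \<le> norm (3 * ((mdist X (\<xi> t) x)\<^sup>2 + (mdist X x y)\<^sup>2 + (mdist X (\<eta> t) y)\<^sup>2))" by simp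
    qed
  qed auto
qed

lemma L2_functions_in_mspace: "\<xi> \<in> L2_functions X \<Longrightarrow> t \<in> space unit_lebesgue \<Longrightarrow> \<xi> t \<in> mspace X"
  by (auto simp: L2_functions_def dest: measurable_space)

lemma pseudometric_L2:
  assumes "second_countable (mtopology_of X)"
  shows "pseudometric_on (L2_functions X) (L2_dist X)"
proof
  fix \<xi> \<eta> \<zeta> assume in_L2: "\<xi> \<in> L2_functions X" "\<eta> \<in> L2_functions X" "\<zeta> \<in> L2_functions X"
  show "L2_dist X \<xi> \<zeta> \<le> L2_dist X \<xi> \<eta> + L2_dist X \<eta> \<zeta>"
    unfolding L2_dist_def using in_L2
    by (intro sqrt_integral_triangle integrable_mdist_L2 assms)
       (auto intro!: mdist_triangle L2_functions_in_mspace)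
next
  fix \<xi> assume "\<xi> \<in> L2_functions X"
  then have "(LINT t|unit_lebesgue. (mdist X (\<xi> t) (\<xi> t))\<^sup>2) = (LINT t|unit_lebesgue. 0)"
    by (intro Bochner_Integration.integral_cong) (simp_all add: L2_functions_in_mspace)
  then show "L2_dist X \<xi> \<xi> = 0" by (simp add: L2_dist_def)
qed (auto simp: L2_dist_def mdist_commute)

lemma ae_equal_eq_zero_rel:
  assumes "second_countable (mtopology_of X)"
  shows "ae_equal X = pseudometric_on.zero_rel (L2_functions X) (L2_dist X)"
proof -
  have "(AE t in unit_lebesgue. \<xi> t = \<eta> t) \<longleftrightarrow> L2_dist X \<xi> \<eta> = 0"
    if in_L2: "\<xi> \<in> L2_functions X" "\<eta> \<in> L2_functions X" for \<xi> \<eta>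
  proof -
    have "L2_dist X \<xi> \<eta> = 0 \<longleftrightarrow> (AE t in unit_lebesgue. (mdist X (\<xi> t) (\<eta> t))\<^sup>2 = 0)"
      unfolding L2_dist_def using integrable_mdist_L2[OF assms in_L2]
      by (simp add: integral_nonneg_eq_0_iff_AE)
    also have "\<dots> \<longleftrightarrow> (AE t in unit_lebesgue. \<xi> t = \<eta> t)"
      using in_L2 by (intro AE_cong) (simp add: L2_functions_in_mspace)
    finally show ?thesis by simp
  qed
  then show ?thesis
    unfolding ae_equal_def pseudometric_on.zero_rel_def[OF pseudometric_L2[OF assms]] by auto
qed

lemma mspace_L2_space:
  "second_countable (mtopology_of X) \<Longrightarrow> mspace (L2_space X) = L2_functions X // ae_equal X"
  unfolding L2_space_def
  by (intro pseudometric_on.mspace_quotient_metric pseudometric_L2 ae_equal_eq_zero_rel)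

lemma mdist_L2_space:
  "\<lbrakk>second_countable (mtopology_of X); \<xi> \<in> L2_functions X; \<eta> \<in> L2_functions X\<rbrakk>
   \<Longrightarrow> mdist (L2_space X) (ae_equal X `` {\<xi>}) (ae_equal X `` {\<eta>}) = L2_dist X \<xi> \<eta>"
  unfolding L2_space_def
  by (intro pseudometric_on.mdist_quotient_metric pseudometric_L2 ae_equal_eq_zero_rel)

text \<open>The values at \<open>z\<close> of the generating sections are dense in \<open>L\<^sup>2([0,1], C\<^sub>z)\<close>, so the fibers of
  the generated field, which are closures of sets of values, are the full \<open>L\<^sup>2\<close> spaces.\<close>

definition randomization :: "('z, 'a) metric_field \<Rightarrow> ('z, (real \<Rightarrow> 'a) set) metric_field" where
  "randomization C =
     generated_field (base C) (\<lambda>z. L2_space (fiber C z))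
       ((\<lambda>s. \<lambda>z\<in>topspace (base C). ae_equal (fiber C z) `` {\<lambda>t. s (z, t)})
          ` cont_sections
              (pullback_field (prod_topology (base C) (top_of_set {0..1::real})) fst C))"

end

theory Submission
  imports Defs
begin

text \<open>Let \<open>f n\<close> be countably many continuous functions on the base such that \<open>f n\<close> is negative outside
  a set \<open>U n\<close> over which the field is trivial and such that at each point some \<open>f n\<close> exceeds \<open>1\<close>.
  A random point \<open>\<xi>\<close> of the fiber at \<open>z\<close> is sent to the random point of the model space that applies
  to \<open>\<xi> t\<close> the trivialization of index \<open>LEAST n. t < f n z\<close>. So the trivializations need not agree on
  overlaps: randomness allows using different ones on different parts of the unit interval, and
  these parts vary continuously in measure with \<open>z\<close>. Continuity of the resulting fiberwise isometries
  follows from dominated convergence for continuous paths of sections, and in general because the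
  values of such paths are dense in the \<open>L\<^sup>2\<close> space of each fiber. For the density, a random point
  with finitely many values is approximated by composing a piecewise geodesic path through sections
  with continuous functions that converge almost everywhere to an integer valued one.\<close>

text \<open>The transition isometries between local trivializations form a cocycle that may obstruct
  the triviality of \<open>C\<close> itself. Once the index depends on \<open>t\<close> as well, it
  jumps only where \<open>t\<close> equals some \<open>f n z\<close>; for fixed \<open>z\<close>
  these are countably many \<open>t\<close>, invisible to the integral. The levels bracket the unit
  interval: as \<open>0 \<le> t\<close>, the inequality \<open>t < f n z\<close> places
  \<open>z\<close> in \<open>U n\<close>, and as \<open>t \<le> 1\<close>, an \<open>n\<close> with
  \<open>f n z > 1\<close> bounds all indices that occur at \<open>z\<close> and near it. So
  finitely many trivializations act near a point, which yields integrability and a local bound for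
  dominated convergence. Second countability yields countably many \<open>f n\<close>, reduces
  continuity on the base to sequences, and makes distances of random points measurable.\<close>

section \<open>Metric preliminaries: continuity by neighborhoods and isometric bijections\<close>

lemma mdist_eq_0_iff [simp]: "\<lbrakk>x \<in> mspace X; y \<in> mspace X\<rbrakk> \<Longrightarrow> mdist X x y = 0 \<longleftrightarrow> x = y"
  by (rule Metric_space.zero[OF Metric_space_mspace_mdist])

lemma mdist_self [simp]: "x \<in> mspace X \<Longrightarrow> mdist X x x = 0"
  by simp

lemma continuous_map_mtopology_of_iff:
  "continuous_map X (mtopology_of M) f \<longleftrightarrow>
     f \<in> topspace X \<rightarrow> mspace M \<and>
     (\<forall>x\<in>topspace X. \<forall>e>0. \<exists>U. openin X U \<and> x \<in> U \<and> (\<forall>y\<in>U. mdist M (f x) (f y) < e))"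
  (is "?L \<longleftrightarrow> ?R")
proof -
  interpret Metric_space "mspace M" "mdist M" by simp
  have *: "continuous_map X (mtopology_of M) f \<longleftrightarrow>
    (\<forall>x \<in> topspace X. \<forall>\<epsilon>>0. \<exists>U. openin X U \<and> x \<in> U \<and> (\<forall>y\<in>U. f y \<in> mball (f x) \<epsilon>))"
    by (simp add: mtopology_of_def continuous_map_to_metric)
  show ?thesis
  proof
    assume L: ?L
    then have "f \<in> topspace X \<rightarrow> mspace M"
      by (metis continuous_map_funspace topspace_mtopology_of)
    with L show ?R unfolding * by (metis in_mball)
  next
    assume R: ?R
    have "f y \<in> mball (f x) e"
      if "openin X U" "x \<in> U" "y \<in> U" "mdist M (f x) (f y) < e" for U x y e
      using that R openin_subset[OF that(1)] by (auto simp: Pi_iff)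
    with R show ?L unfolding * by meson
  qed
qed

lemma continuous_map_mtopology_ofD:
  assumes "continuous_map X (mtopology_of M) f" "x \<in> topspace X" "0 < e"
  obtains U where "openin X U" "x \<in> U" "\<And>y. y \<in> U \<Longrightarrow> mdist M (f x) (f y) < e"
  using assms unfolding continuous_map_mtopology_of_iff by meson

lemma continuous_map_euclideanreal_iff:
  "continuous_map X euclideanreal f \<longleftrightarrow>
     (\<forall>x\<in>topspace X. \<forall>e>0. \<exists>U. openin X U \<and> x \<in> U \<and> (\<forall>y\<in>U. \<bar>f x - f y\<bar> < e))"
  by (simp add: Met_TC.continuous_map_to_metric dist_real_def flip: mtopology_is_euclidean)

lemma continuous_map_euclideanrealD:
  assumes "continuous_map X euclideanreal f" "x \<in> topspace X" "0 < e"
  obtains U where "openin X U" "x \<in> U" "\<And>y. y \<in> U \<Longrightarrow> \<bar>f x - f y\<bar> < e"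
  using assms unfolding continuous_map_euclideanreal_iff by meson

lemma isometric_bij_mem: "\<lbrakk>isometric_bij X Y f; x \<in> mspace X\<rbrakk> \<Longrightarrow> f x \<in> mspace Y"
  by (auto simp: isometric_bij_def bij_betw_def)

lemma isometric_bij_dist:
  "\<lbrakk>isometric_bij X Y f; x \<in> mspace X; y \<in> mspace X\<rbrakk> \<Longrightarrow> mdist Y (f x) (f y) = mdist X x y"
  by (auto simp: isometric_bij_def)

lemma isometric_bij_comp:
  "\<lbrakk>isometric_bij X Y f; isometric_bij Y Z g\<rbrakk> \<Longrightarrow> isometric_bij X Z (g \<circ> f)"
  unfolding isometric_bij_def by (auto intro: bij_betw_trans dest: bij_betwE)

lemma isometric_bij_inv:
  assumes "isometric_bij X Y f"
  shows "isometric_bij Y X (inv_into (mspace X) f)"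
proof -
  have b: "bij_betw f (mspace X) (mspace Y)" using assms by (simp add: isometric_bij_def)
  have "mdist X (inv_into (mspace X) f u) (inv_into (mspace X) f v) = mdist Y u v"
    if "u \<in> mspace Y" "v \<in> mspace Y" for u v
    using isometric_bij_dist[OF assms, of "inv_into (mspace X) f u" "inv_into (mspace X) f v"] that b
    by (metis bij_betw_def bij_betw_inv_into_right inv_into_into)
  then show ?thesis using b by (simp add: isometric_bij_def bij_betw_inv_into)
qed

lemma continuous_map_isometric_bij:
  assumes "isometric_bij X Y f"
  shows "continuous_map (mtopology_of X) (mtopology_of Y) f"
  unfolding continuous_map_mtopology_of_iff
proof (intro conjI ballI allI impI)
  show "f \<in> topspace (mtopology_of X) \<rightarrow> mspace Y"
    using isometric_bij_mem[OF assms] by auto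
  fix x and e :: real assume x: "x \<in> topspace (mtopology_of X)" "0 < e"
  interpret Metric_space "mspace X" "mdist X" by simp
  show "\<exists>U. openin (mtopology_of X) U \<and> x \<in> U \<and> (\<forall>y\<in>U. mdist Y (f x) (f y) < e)"
    using x isometric_bij_dist[OF assms]
    by (intro exI[of _ "mball x e"]) (auto simp: mtopology_of_def)
qed

section \<open>Continuous fields and their pullbacks\<close>

lemma
  assumes "continuous_field C"
  shows field_section_mem: "\<lbrakk>u \<in> cont_sections C; z \<in> topspace (base C)\<rbrakk> \<Longrightarrow> u z \<in> mspace (fiber C z)"
    and field_section_ext: "\<lbrakk>u \<in> cont_sections C; z \<notin> topspace (base C)\<rbrakk> \<Longrightarrow> u z = undefined"
    and field_dist_continuous: "\<lbrakk>u \<in> cont_sections C; v \<in> cont_sections C\<rbrakk>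
      \<Longrightarrow> continuous_map (base C) euclideanreal (\<lambda>z. mdist (fiber C z) (u z) (v z))"
    and field_closure: "z \<in> topspace (base C) \<Longrightarrow>
      mtopology_of (fiber C z) closure_of ((\<lambda>s. s z) ` cont_sections C) = mspace (fiber C z)"
  using assms unfolding continuous_field_def all_sections_def co_continuous_def by blast+

lemma metric_closure_approx:
  assumes "x \<in> mtopology_of X closure_of S" "0 < e"
  obtains y where "y \<in> S" "y \<in> mspace X" "mdist X x y < e"
proof -
  interpret Metric_space "mspace X" "mdist X" by simp
  show thesis using assms that unfolding mtopology_of_def metric_closure_of by auto
qed

lemma metric_closureI:
  assumes "x \<in> mspace X" "\<And>e. 0 < e \<Longrightarrow> \<exists>y\<in>S. y \<in> mspace X \<and> mdist X x y < e"
  shows "x \<in> mtopology_of X closure_of S"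
proof -
  interpret Metric_space "mspace X" "mdist X" by simp
  show ?thesis using assms unfolding mtopology_of_def metric_closure_of by auto
qed

lemma field_dense:
  assumes "continuous_field C" "z \<in> topspace (base C)" "x \<in> mspace (fiber C z)" "0 < e"
  obtains u where "u \<in> cont_sections C" "mdist (fiber C z) x (u z) < e"
  by (rule metric_closure_approx[of x "fiber C z" "(\<lambda>s. s z) ` cont_sections C" e])
     (use assms that field_closure[OF assms(1,2)] in auto)

text \<open>Pointwise density of the continuous sections makes the closure taken in
  \<open>generated_field\<close> the whole fiber, so the submetric is the original one. Restricting
  the generators to \<open>topspace Y\<close> does not affect continuity on
  \<open>Y\<close>.\<close>

lemma
  assumes C: "continuous_field C" and f: "\<And>y. y \<in> topspace Y \<Longrightarrow> f y \<in> topspace (base C)"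
  shows fiber_pullback: "y \<in> topspace Y \<Longrightarrow> fiber (pullback_field Y f C) y = fiber C (f y)"
    and cont_sections_pullback: "cont_sections (pullback_field Y f C) =
      {s \<in> all_sections Y (\<lambda>y. fiber C (f y)).
        \<forall>u\<in>cont_sections C. continuous_map Y euclideanreal (\<lambda>y. mdist (fiber C (f y)) (s y) (u (f y)))}"
proof -
  have im: "(\<lambda>s. s y) ` (\<lambda>s. restrict (s \<circ> f) (topspace Y)) ` cont_sections C
      = (\<lambda>s. s (f y)) ` cont_sections C" if "y \<in> topspace Y" for y
    using that by (auto simp: image_image)
  show fib: "fiber (pullback_field Y f C) y = fiber C (f y)" if "y \<in> topspace Y" for y
    using field_closure[OF C f[OF that]] that
    by (simp add: pullback_field_def generated_field_def Let_def im)
  have all: "all_sections Y (fiber (pullback_field Y f C)) = all_sections Y (\<lambda>y. fiber C (f y))"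
    unfolding all_sections_def by (intro PiE_cong) (simp add: fib)
  have co: "co_continuous Y (\<lambda>y. fiber C (f y)) s (restrict (u \<circ> f) (topspace Y)) \<longleftrightarrow>
      continuous_map Y euclideanreal (\<lambda>y. mdist (fiber C (f y)) (s y) (u (f y)))" for s u
    unfolding co_continuous_def by (intro iffI; erule continuous_map_eq) auto
  show "cont_sections (pullback_field Y f C) =
      {s \<in> all_sections Y (\<lambda>y. fiber C (f y)).
        \<forall>u\<in>cont_sections C. continuous_map Y euclideanreal (\<lambda>y. mdist (fiber C (f y)) (s y) (u (f y)))}"
    using all by (simp add: pullback_field_def generated_field_def Let_def co)
qed

section \<open>Continuous paths of sections, which generate the randomization\<close>

abbreviation path_sections :: "('z, 'a) metric_field \<Rightarrow> ('z \<times> real \<Rightarrow> 'a) set" where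
  "path_sections C \<equiv>
     cont_sections (pullback_field (prod_topology (base C) (top_of_set {0..1::real})) fst C)"

lemma path_sections_iff:
  assumes "continuous_field C"
  shows "s \<in> path_sections C \<longleftrightarrow>
    s \<in> (\<Pi>\<^sub>E (z, t) \<in> topspace (base C) \<times> {0..1}. mspace (fiber C z)) \<and>
    (\<forall>u\<in>cont_sections C. continuous_map (prod_topology (base C) (top_of_set {0..1})) euclideanreal
       (\<lambda>(z, t). mdist (fiber C z) (s (z, t)) (u z)))"
  by (subst cont_sections_pullback[OF assms])
     (auto simp: all_sections_def case_prod_unfold)

lemma path_section_mem:
  "\<lbrakk>continuous_field C; s \<in> path_sections C; z \<in> topspace (base C); t \<in> {0..1}\<rbrakk>
    \<Longrightarrow> s (z, t) \<in> mspace (fiber C z)"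
  unfolding path_sections_iff by auto

text \<open>Co-continuity passes to the slice along \<open>z \<mapsto> (z, t)\<close>, and the
  maximality axiom of a continuous field turns it into membership. This makes the local
  trivializations applicable at fixed \<open>t\<close>.\<close>

lemma path_section_slice:
  assumes C: "continuous_field C" and s: "s \<in> path_sections C" and t: "t \<in> {0..1}"
  shows "(\<lambda>z\<in>topspace (base C). s (z, t)) \<in> cont_sections C" (is "?s \<in> _")
proof -
  have "co_continuous (base C) (fiber C) ?s u" if u: "u \<in> cont_sections C" for u
  proof -
    have "continuous_map (base C) euclideanreal
       ((\<lambda>(z, t). mdist (fiber C z) (s (z, t)) (u z)) \<circ> (\<lambda>z. (z, t)))"
      using s u t unfolding path_sections_iff[OF C]
      by (intro continuous_map_compose[of _ "prod_topology (base C) (top_of_set {0..1})"])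
         (auto intro!: continuous_map_pairedI)
    then show ?thesis unfolding co_continuous_def by (rule continuous_map_eq) auto
  qed
  moreover have "?s \<in> all_sections (base C) (fiber C)"
    using path_section_mem[OF C s _ t] by (simp add: all_sections_def)
  ultimately show ?thesis using C unfolding continuous_field_def by blast
qed

section \<open>Measurable functions into metric spaces\<close>

text \<open>Each point of a countable dense set is replaced by points of \<open>D\<close> within
  \<open>1/(n+1)\<close> of it. The purpose is to thin out the values of all continuous sections, a
  dense set that is in general uncountable.\<close>

lemma countable_dense_subset:
  assumes "second_countable (mtopology_of X)" "D \<subseteq> mspace X"
    and dense: "\<And>x e. x \<in> mspace X \<Longrightarrow> 0 < e \<Longrightarrow> \<exists>c\<in>D. mdist X x c < e"
  obtains E where "countable E" "E \<subseteq> D" "\<And>x e. x \<in> mspace X \<Longrightarrow> 0 < e \<Longrightarrow> \<exists>c\<in>E. mdist X x c < e"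
proof -
  obtain A where A: "countable A" "A \<subseteq> mspace X"
    "\<And>x e. x \<in> mspace X \<Longrightarrow> e > 0 \<Longrightarrow> \<exists>c\<in>A. mdist X x c < e"
    by (rule countable_dense_mspace[OF assms(1)]) blast
  have "\<forall>a\<in>A. \<forall>n. \<exists>c\<in>D. mdist X a c < inverse (real (Suc n))"
    using dense A(2) by (metis inverse_positive_iff_positive of_nat_0_less_iff subsetD zero_less_Suc)
  then obtain p where p: "\<And>a n. a \<in> A \<Longrightarrow> p a n \<in> D \<and> mdist X a (p a n) < inverse (real (Suc n))"
    by metis
  show thesis
  proof
    show "countable ((\<lambda>(a, n). p a n) ` (A \<times> UNIV))" using A(1) by auto
    show "(\<lambda>(a, n). p a n) ` (A \<times> UNIV) \<subseteq> D" using p by auto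
    fix x and e :: real assume x: "x \<in> mspace X" "0 < e"
    obtain a where a: "a \<in> A" "mdist X x a < e / 2" using A(3)[OF x(1), of "e / 2"] x(2) by auto
    obtain n where n: "inverse (real (Suc n)) < e / 2"
      using reals_Archimedean[of "e / 2"] x(2) by auto
    have "mdist X x (p a n) \<le> mdist X x a + mdist X a (p a n)"
      using x a p assms(2) A(2) by (intro mdist_triangle) auto
    then have "mdist X x (p a n) < e" using a p[OF a(1), of n] n by linarith
    then show "\<exists>c\<in>(\<lambda>(a, n). p a n) ` (A \<times> UNIV). mdist X x c < e" using a by auto
  qed
qed

text \<open>In a separable space an open set is a countable union of balls with centers in a
  countable dense set and rational radii, and preimages of such balls are sublevel sets of distance
  functions. So only distances to the points of a dense set have to be examined.\<close>

lemma measurable_metric_borelI: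
  assumes "second_countable (mtopology_of X)" "D \<subseteq> mspace X"
    and dense: "\<And>x e. x \<in> mspace X \<Longrightarrow> 0 < e \<Longrightarrow> \<exists>c\<in>D. mdist X x c < e"
    and sp: "\<And>t. t \<in> space M \<Longrightarrow> \<xi> t \<in> mspace X"
    and meas: "\<And>c. c \<in> D \<Longrightarrow> (\<lambda>t. mdist X (\<xi> t) c) \<in> borel_measurable M"
  shows "\<xi> \<in> measurable M (metric_borel X)"
  unfolding metric_borel_def
proof (rule measurable_measure_of)
  show "{U. openin (mtopology_of X) U} \<subseteq> Pow (mspace X)"
    using openin_subset[of "mtopology_of X"] by auto
  show "\<xi> \<in> space M \<rightarrow> mspace X" using sp by auto
  fix U assume "U \<in> {U. openin (mtopology_of X) U}"
  interpret Metric_space "mspace X" "mdist X" by simp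
  have U: "U \<subseteq> mspace X" "\<And>x. x \<in> U \<Longrightarrow> \<exists>r>0. mball x r \<subseteq> U"
    using \<open>U \<in> _\<close> by (auto simp: mtopology_of_def openin_mtopology)
  obtain E where E: "countable E" "E \<subseteq> D" "\<And>x e. x \<in> mspace X \<Longrightarrow> 0 < e \<Longrightarrow> \<exists>c\<in>E. mdist X x c < e"
    by (rule countable_dense_subset[OF assms(1,2) dense]) blast+
  define I where "I = {(c, r). c \<in> E \<and> r \<in> \<rat> \<and> mball c r \<subseteq> U}"
  have "I \<subseteq> E \<times> \<rat>" by (auto simp: I_def)
  then have cI: "countable I" by (rule countable_subset) (use E(1) countable_rat in auto)
  have "\<xi> -` U \<inter> space M = (\<Union>(c, r)\<in>I. {t \<in> space M. mdist X (\<xi> t) c < r})"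
  proof (intro equalityI subsetI)
    fix t assume t: "t \<in> \<xi> -` U \<inter> space M"
    then obtain r where r: "r > 0" "mball (\<xi> t) r \<subseteq> U" using U(2)[of "\<xi> t"] by auto
    obtain c where c: "c \<in> E" "mdist X (\<xi> t) c < r / 3"
      using E(3)[of "\<xi> t" "r / 3"] sp t r by auto
    \<comment> \<open>A radius above \<open>r / 3\<close> puts \<open>\<xi> t\<close> in the ball
      around \<open>c\<close>; a radius below \<open>r / 2\<close> keeps that ball within
      \<open>r\<close> of \<open>\<xi> t\<close>.\<close>
    obtain q where q: "q \<in> \<rat>" "r / 3 < q" "q < r / 2" using Rats_dense_in_real[of "r/3" "r/2"] r by auto
    have cX: "c \<in> mspace X" using c E assms(2) by auto
    have "mball c q \<subseteq> mball (\<xi> t) r"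
    proof
      fix y assume "y \<in> mball c q"
      then show "y \<in> mball (\<xi> t) r"
        using mdist_triangle[of "\<xi> t" X c y] sp t cX c q by auto
    qed
    then have "(c, q) \<in> I" using c q r by (auto simp: I_def)
    then show "t \<in> (\<Union>(c, r)\<in>I. {t \<in> space M. mdist X (\<xi> t) c < r})" using t c q by force
  next
    fix t assume "t \<in> (\<Union>(c, r)\<in>I. {t \<in> space M. mdist X (\<xi> t) c < r})"
    then obtain c r where "(c, r) \<in> I" "t \<in> space M" "mdist X (\<xi> t) c < r" by auto
    moreover from this have "\<xi> t \<in> mball c r"
      using E assms(2) sp by (auto simp: I_def commute)
    ultimately show "t \<in> \<xi> -` U \<inter> space M" by (auto simp: I_def)
  qed
  also have "\<dots> \<in> sets M"
  proof (rule sets.countable_UN''[OF cI], clarify)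
    fix c r assume "(c, r) \<in> I"
    then have [measurable]: "(\<lambda>t. mdist X (\<xi> t) c) \<in> borel_measurable M"
      using E by (intro meas) (auto simp: I_def)
    show "{t \<in> space M. mdist X (\<xi> t) c < r} \<in> sets M" by measurable
  qed
  finally show "\<xi> -` U \<inter> space M \<in> sets M" .
qed

lemma finite_measure_unit_lebesgue: "finite_measure unit_lebesgue"
  by (rule finite_measure_lebesgue_on) auto

lemma AE_unit_lebesgue_negligible:
  assumes "negligible N"
  shows "AE t in unit_lebesgue. t \<notin> N"
proof -
  have "AE t in lebesgue. t \<notin> N"
    using assms by (simp add: negligible_iff_null_sets AE_not_in)
  then show ?thesis by (auto simp: AE_restrict_space_iff elim: eventually_mono)
qed

lemma L2_functions_measurable: "\<xi> \<in> L2_functions X \<Longrightarrow> \<xi> \<in> measurable unit_lebesgue (metric_borel X)"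
  by (simp add: L2_functions_def)

lemma bounded_L2_functions:
  assumes "\<xi> \<in> measurable unit_lebesgue (metric_borel X)" "x \<in> mspace X"
    and "\<And>t. t \<in> {0..1} \<Longrightarrow> mdist X (\<xi> t) x \<le> B"
  shows "\<xi> \<in> L2_functions X"
proof -
  interpret finite_measure unit_lebesgue by (rule finite_measure_unit_lebesgue)
  have [measurable]: "(\<lambda>t. mdist X (\<xi> t) x) \<in> borel_measurable unit_lebesgue"
    by (rule measurable_compose[OF assms(1) measurable_mdist_const[OF assms(2)]])
  have "integrable unit_lebesgue (\<lambda>t. (mdist X (\<xi> t) x)\<^sup>2)"
    by (rule integrable_const_bound[of _ "B\<^sup>2"])
       (auto intro!: AE_I2 power_mono assms(3))
  then show ?thesis using assms by (auto simp: L2_functions_def)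
qed

lemma L2_dist_tendsto_0:
  assumes sc: "second_countable (mtopology_of X)"
    and \<xi>: "\<xi> \<in> L2_functions X" and f: "\<And>n. f n \<in> L2_functions X"
    and g: "integrable unit_lebesgue (\<lambda>t. (g t)\<^sup>2)"
    and le: "\<And>n t. t \<in> {0..1} \<Longrightarrow> mdist X (f n t) (\<xi> t) \<le> g t"
    and lim: "AE t in unit_lebesgue. (\<lambda>n. mdist X (f n t) (\<xi> t)) \<longlonglongrightarrow> 0"
  shows "(\<lambda>n. L2_dist X (f n) \<xi>) \<longlonglongrightarrow> 0"
proof -
  have "(\<lambda>n. LINT t|unit_lebesgue. (mdist X (f n t) (\<xi> t))\<^sup>2) \<longlonglongrightarrow> (LINT t|unit_lebesgue. 0)"
  proof (rule integral_dominated_convergence[OF _ _ g])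
    show "(\<lambda>t. (mdist X (f n t) (\<xi> t))\<^sup>2) \<in> borel_measurable unit_lebesgue" for n
      using integrable_mdist_L2[OF sc f \<xi>] by (rule borel_measurable_integrable)
    show "AE t in unit_lebesgue. norm ((mdist X (f n t) (\<xi> t))\<^sup>2) \<le> (g t)\<^sup>2" for n
      by (rule AE_I2) (auto intro!: power_mono le)
    show "AE t in unit_lebesgue. (\<lambda>n. (mdist X (f n t) (\<xi> t))\<^sup>2) \<longlonglongrightarrow> 0"
      using lim
    proof eventually_elim
      case (elim t)
      from tendsto_power[OF elim, of 2] show ?case by simp
    qed
  qed auto
  from tendsto_real_sqrt[OF this] show ?thesis by (simp add: L2_dist_def)
qed

lemma ae_equal_iff:
  "(\<xi>, \<eta>) \<in> ae_equal X \<longleftrightarrow>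
    \<xi> \<in> L2_functions X \<and> \<eta> \<in> L2_functions X \<and> (AE t in unit_lebesgue. \<xi> t = \<eta> t)"
  by (simp add: ae_equal_def)

lemma equiv_ae_equal: "equiv (L2_functions X) (ae_equal X)"
proof (rule equivI)
  show "trans (ae_equal X)"
    by (rule transI) (auto simp: ae_equal_iff elim: AE_mp)
qed (auto simp: refl_on_def sym_def ae_equal_iff elim: AE_mp)

lemma L2_space_cases:
  assumes "second_countable (mtopology_of X)" "P \<in> mspace (L2_space X)"
  obtains \<xi> where "\<xi> \<in> L2_functions X" "P = ae_equal X `` {\<xi>}"
  using assms by (auto simp: mspace_L2_space elim: quotientE)

lemma L2_class_mem:
  "\<lbrakk>second_countable (mtopology_of X); \<xi> \<in> L2_functions X\<rbrakk> \<Longrightarrow> ae_equal X `` {\<xi>} \<in> mspace (L2_space X)"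
  by (simp add: mspace_L2_space quotientI)

lemma L2_class_eqI:
  "\<lbrakk>\<xi> \<in> L2_functions X; \<eta> \<in> L2_functions X; AE t in unit_lebesgue. \<xi> t = \<eta> t\<rbrakk>
    \<Longrightarrow> ae_equal X `` {\<xi>} = ae_equal X `` {\<eta>}"
  by (intro equiv_class_eq[OF equiv_ae_equal]) (simp add: ae_equal_iff)

section \<open>Piecewise isometries of \<open>L\<^sup>2\<close> spaces\<close>

text \<open>\<open>F\<close> acts on an arbitrary representative; that the choice is immaterial for
  the maps in question is shown in \<open>L2_map_class\<close>.\<close>

definition L2_map :: "'b metric \<Rightarrow> (real \<Rightarrow> 'a \<Rightarrow> 'b) \<Rightarrow> (real \<Rightarrow> 'a) set \<Rightarrow> (real \<Rightarrow> 'b) set" where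
  "L2_map Y F P = ae_equal Y `` {\<lambda>t. F t ((SOME \<xi>. \<xi> \<in> P) t)}"

lemma finite_range_L2_functions:
  assumes "N \<in> measurable unit_lebesgue (count_space UNIV)" "finite (N ` {0..1})"
    and "\<And>t. t \<in> {0..1} \<Longrightarrow> c (N t) \<in> mspace X"
  shows "(\<lambda>t. c (N t)) \<in> L2_functions X"
proof -
  define x where "x = c (N 0)"
  \<comment> \<open>\<open>c\<close> may leave \<open>mspace X\<close> at indices that
    \<open>N\<close> does not take; the default \<open>x\<close> makes it a map of the whole
    discrete index space into \<open>X\<close>, hence measurable.\<close>
  define c' where "c' n = (if c n \<in> mspace X then c n else x)" for n
  have x: "x \<in> mspace X" using assms(3)[of 0] by (simp add: x_def)
  have "(\<lambda>t. c' (N t)) \<in> measurable unit_lebesgue (metric_borel X)"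
    by (rule measurable_compose[OF assms(1)]) (auto simp: c'_def x)
  then have meas: "(\<lambda>t. c (N t)) \<in> measurable unit_lebesgue (metric_borel X)"
    by (rule subst[OF measurable_cong, rotated]) (auto simp: c'_def assms(3))
  show ?thesis
  proof (rule bounded_L2_functions[OF meas x])
    fix t :: real assume "t \<in> {0..1}"
    then show "mdist X (c (N t)) x \<le> Max ((\<lambda>n. mdist X (c n) x) ` N ` {0..1})"
      using assms(2) by (intro Max_ge) auto
  qed
qed

text \<open>A measurable choice among finitely many isometries. The discrete sigma-algebra on the
  indices avoids any measurable structure on the isometries themselves; finiteness bounds how far
  base points are moved, so that square integrability is preserved.\<close>

locale piecewise_isometry =
  fixes X :: "'a metric" and Y :: "'b metric" and \<psi> :: "'n \<Rightarrow> 'a \<Rightarrow> 'b" and N :: "real \<Rightarrow> 'n"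
  assumes second_countable_X: "second_countable (mtopology_of X)"
    and second_countable_Y: "second_countable (mtopology_of Y)"
    and N_measurable: "N \<in> measurable unit_lebesgue (count_space UNIV)"
    and N_finite: "finite (N ` {0..1})"
    and iso: "t \<in> {0..1} \<Longrightarrow> isometric_bij X Y (\<psi> (N t))"
begin

text \<open>The isometry \<open>\<psi> (N t)\<close> turns the distance to \<open>y\<close> into the
  distance to the preimage \<open>c y (N t)\<close>. As a function of \<open>t\<close> this preimage
  takes finitely many values, hence is itself an L2 function, and measurability and integrability
  are inherited from \<open>X\<close>.\<close>

lemma L2_function:
  assumes \<xi>: "\<xi> \<in> L2_functions X"
  shows "(\<lambda>t. \<psi> (N t) (\<xi> t)) \<in> L2_functions Y"
proof -
  have \<xi>m: "\<xi> t \<in> mspace X" if "t \<in> {0..1}" for t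
    using L2_functions_in_mspace[OF \<xi>, of t] that by simp
  have mem: "\<psi> (N t) (\<xi> t) \<in> mspace Y" if "t \<in> {0..1}" for t
    by (rule isometric_bij_mem[OF iso[OF that] \<xi>m[OF that]])
  define c where "c y n = inv_into (mspace X) (\<psi> n) y" for y n
  have cm: "c y (N t) \<in> mspace X" "\<psi> (N t) (c y (N t)) = y" if "y \<in> mspace Y" "t \<in> {0..1}" for y t
    using iso[OF that(2)] that(1)
    by (auto simp: c_def isometric_bij_def bij_betw_def inv_into_into f_inv_into_f)
  have cL: "(\<lambda>t. c y (N t)) \<in> L2_functions X" if "y \<in> mspace Y" for y
    using that by (intro finite_range_L2_functions N_measurable N_finite cm)
  have eq: "mdist Y (\<psi> (N t) (\<xi> t)) y = mdist X (\<xi> t) (c y (N t))" if "y \<in> mspace Y" "t \<in> {0..1}" for y t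
    using isometric_bij_dist[OF iso[OF that(2)] \<xi>m[OF that(2)] cm(1)[OF that]] cm(2)[OF that] by simp
  have meas: "(\<lambda>t. \<psi> (N t) (\<xi> t)) \<in> measurable unit_lebesgue (metric_borel Y)"
  proof (rule measurable_metric_borelI[OF second_countable_Y subset_refl])
    fix y assume y: "y \<in> mspace Y"
    have "(\<lambda>t. mdist X (\<xi> t) (c y (N t))) \<in> borel_measurable unit_lebesgue"
      using \<xi> cL[OF y] by (intro measurable_mdist second_countable_X L2_functions_measurable)
    then show "(\<lambda>t. mdist Y (\<psi> (N t) (\<xi> t)) y) \<in> borel_measurable unit_lebesgue"
      by (rule subst[OF measurable_cong, rotated]) (simp add: eq y)
    show "0 < e \<Longrightarrow> \<exists>c\<in>mspace Y. mdist Y y c < e" for e using y by (intro bexI[of _ y]) simp_all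
  qed (use mem in auto)
  obtain y where y: "y \<in> mspace Y" using mem[of 0] by auto
  have "integrable unit_lebesgue (\<lambda>t. (mdist Y (\<psi> (N t) (\<xi> t)) y)\<^sup>2) \<longleftrightarrow>
      integrable unit_lebesgue (\<lambda>t. (mdist X (\<xi> t) (c y (N t)))\<^sup>2)"
    by (rule Bochner_Integration.integrable_cong) (simp_all add: eq y)
  then show ?thesis
    using meas y integrable_mdist_L2[OF second_countable_X \<xi> cL[OF y]] by (auto simp: L2_functions_def)
qed

lemma L2_map_class:
  assumes \<xi>: "\<xi> \<in> L2_functions X"
  shows "L2_map Y (\<lambda>t. \<psi> (N t)) (ae_equal X `` {\<xi>}) = ae_equal Y `` {\<lambda>t. \<psi> (N t) (\<xi> t)}"
proof -
  define \<eta> where "\<eta> = (SOME \<eta>. \<eta> \<in> ae_equal X `` {\<xi>})"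
  have "\<xi> \<in> ae_equal X `` {\<xi>}" using \<xi> by (simp add: ae_equal_iff)
  then have "\<eta> \<in> ae_equal X `` {\<xi>}" unfolding \<eta>_def by (rule someI[of "\<lambda>\<eta>. \<eta> \<in> _"])
  then have \<eta>: "\<eta> \<in> L2_functions X" "AE t in unit_lebesgue. \<xi> t = \<eta> t"
    by (auto simp: ae_equal_iff)
  have "AE t in unit_lebesgue. \<psi> (N t) (\<eta> t) = \<psi> (N t) (\<xi> t)"
    using \<eta>(2) by eventually_elim simp
  then show ?thesis
    unfolding L2_map_def \<eta>_def[symmetric] by (intro L2_class_eqI L2_function \<xi> \<eta>(1))
qed

lemma L2_dist_eq:
  assumes "\<xi> \<in> L2_functions X" "\<eta> \<in> L2_functions X"
  shows "L2_dist Y (\<lambda>t. \<psi> (N t) (\<xi> t)) (\<lambda>t. \<psi> (N t) (\<eta> t)) = L2_dist X \<xi> \<eta>"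
proof -
  have "(LINT t|unit_lebesgue. (mdist Y (\<psi> (N t) (\<xi> t)) (\<psi> (N t) (\<eta> t)))\<^sup>2)
      = (LINT t|unit_lebesgue. (mdist X (\<xi> t) (\<eta> t))\<^sup>2)"
  proof (rule Bochner_Integration.integral_cong)
    fix t assume t: "t \<in> space unit_lebesgue"
    then have "t \<in> {0..1}" by simp
    then show "(mdist Y (\<psi> (N t) (\<xi> t)) (\<psi> (N t) (\<eta> t)))\<^sup>2 = (mdist X (\<xi> t) (\<eta> t))\<^sup>2"
      using isometric_bij_dist[OF iso] assms[THEN L2_functions_in_mspace, OF t] by simp
  qed simp
  then show ?thesis by (simp add: L2_dist_def)
qed

text \<open>Surjectivity holds because the inverse isometries with the same \<open>N\<close> form a
  piecewise isometry in the opposite direction.\<close>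

lemma isometric_bij_L2_map:
  "isometric_bij (L2_space X) (L2_space Y) (L2_map Y (\<lambda>t. \<psi> (N t)))" (is "isometric_bij _ _ ?F")
proof -
  let ?X = "mspace (L2_space X)" and ?Y = "mspace (L2_space Y)"
  have mem: "?F P \<in> ?Y" if "P \<in> ?X" for P
    using that
    by (elim L2_space_cases[OF second_countable_X])
       (auto simp: L2_map_class intro!: L2_class_mem second_countable_Y L2_function)
  have dist: "mdist (L2_space Y) (?F P) (?F Q) = mdist (L2_space X) P Q" if PQ: "P \<in> ?X" "Q \<in> ?X" for P Q
  proof -
    obtain \<xi> \<eta> where "\<xi> \<in> L2_functions X" "P = ae_equal X `` {\<xi>}" "\<eta> \<in> L2_functions X" "Q = ae_equal X `` {\<eta>}"
      using PQ by (metis L2_space_cases[OF second_countable_X])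
    then show ?thesis
      by (simp add: L2_map_class mdist_L2_space second_countable_X second_countable_Y L2_function L2_dist_eq)
  qed
  have surj: "\<exists>P\<in>?X. Q = ?F P" if Q: "Q \<in> ?Y" for Q
  proof -
    obtain \<eta> where \<eta>: "\<eta> \<in> L2_functions Y" "Q = ae_equal Y `` {\<eta>}"
      using Q by (rule L2_space_cases[OF second_countable_Y])
    interpret inv: piecewise_isometry Y X "\<lambda>n. inv_into (mspace X) (\<psi> n)" N
      by standard
        (rule second_countable_X second_countable_Y N_measurable N_finite isometric_bij_inv[OF iso]
          | assumption)+
    define \<xi> where "\<xi> = (\<lambda>t. inv_into (mspace X) (\<psi> (N t)) (\<eta> t))"
    have \<xi>: "\<xi> \<in> L2_functions X" unfolding \<xi>_def by (rule inv.L2_function[OF \<eta>(1)])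
    have "\<psi> (N t) (\<xi> t) = \<eta> t" if "t \<in> space unit_lebesgue" for t
    proof -
      have "\<eta> t \<in> \<psi> (N t) ` mspace X"
        using iso[of t] L2_functions_in_mspace[OF \<eta>(1) that] that
        by (auto simp: isometric_bij_def bij_betw_def)
      then show ?thesis unfolding \<xi>_def by (rule f_inv_into_f)
    qed
    then have "AE t in unit_lebesgue. \<psi> (N t) (\<xi> t) = \<eta> t" by (rule AE_I2)
    then have "?F (ae_equal X `` {\<xi>}) = Q"
      unfolding L2_map_class[OF \<xi>] \<eta>(2) by (intro L2_class_eqI L2_function \<xi> \<eta>(1))
    then show ?thesis using L2_class_mem[OF second_countable_X \<xi>] by blast
  qed
  have "inj_on ?F ?X"
  proof (rule inj_onI)
    fix P Q assume PQ: "P \<in> ?X" "Q \<in> ?X" "?F P = ?F Q"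
    then have "mdist (L2_space X) P Q = 0" using dist[OF PQ(1,2)] mem[OF PQ(1)] by simp
    then show "P = Q" using PQ by simp
  qed
  then show ?thesis unfolding isometric_bij_def bij_betw_def using mem dist surj by blast
qed

end

section \<open>Sections following piecewise geodesic paths\<close>

definition geodesic_between :: "'a metric \<Rightarrow> 'a \<Rightarrow> 'a \<Rightarrow> real \<Rightarrow> 'a" where
  "geodesic_between X x y = (SOME \<gamma>. geodesic_path X x y \<gamma>)"

lemma
  assumes "geodesic_space X" "x \<in> mspace X" "y \<in> mspace X"
  shows geodesic_between_0 [simp]: "geodesic_between X x y 0 = x"
    and geodesic_between_1 [simp]: "geodesic_between X x y 1 = y"
    and geodesic_between_mem: "s \<in> {0..1} \<Longrightarrow> geodesic_between X x y s \<in> mspace X"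
    and geodesic_between_dist: "\<lbrakk>s \<in> {0..1}; t \<in> {0..1}\<rbrakk> \<Longrightarrow>
      mdist X (geodesic_between X x y s) (geodesic_between X x y t) = \<bar>s - t\<bar> * mdist X x y"
proof -
  have "geodesic_path X x y (geodesic_between X x y)"
    unfolding geodesic_between_def using assms unfolding geodesic_space_def by (metis someI_ex)
  then show "geodesic_between X x y 0 = x" "geodesic_between X x y 1 = y"
    "s \<in> {0..1} \<Longrightarrow> geodesic_between X x y s \<in> mspace X"
    "\<lbrakk>s \<in> {0..1}; t \<in> {0..1}\<rbrakk> \<Longrightarrow>
      mdist X (geodesic_between X x y s) (geodesic_between X x y t) = \<bar>s - t\<bar> * mdist X x y"
    unfolding geodesic_path_def by auto
qed

lemma
  assumes "continuous_field C" "z \<in> topspace (base C)"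
  shows field_nonempty: "mspace (fiber C z) \<noteq> {}"
    and field_geodesic: "geodesic_space (fiber C z)"
  using assms unfolding continuous_field_def hilbert_hadamard_def by meson+

lemma field_midpoint_closed:
  "\<lbrakk>continuous_field C; u \<in> cont_sections C; v \<in> cont_sections C; m \<in> all_sections (base C) (fiber C);
    \<And>z. z \<in> topspace (base C) \<Longrightarrow> is_midpoint (fiber C z) (u z) (v z) (m z)\<rbrakk> \<Longrightarrow> m \<in> cont_sections C"
  unfolding continuous_field_def by blast

lemma dyadic_in_unit: "k \<le> 2 ^ n \<Longrightarrow> real k / 2 ^ n \<in> {0..1}"
  by (auto simp: divide_le_eq_1)

text \<open>The geodesics are chosen independently in each fiber. Still, an odd multiple of
  \<open>1 / 2 ^ (n + 1)\<close> gives the midpoint of two neighboring points of level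
  \<open>n\<close> on the same geodesic, so closure under pointwise midpoints yields continuity in
  \<open>z\<close>. Even multiples already occur at level \<open>n\<close>.\<close>

lemma dyadic_geodesic_section:
  assumes C: "continuous_field C" and u: "u \<in> cont_sections C" and v: "v \<in> cont_sections C"
  shows "k \<le> 2 ^ n \<Longrightarrow>
    (\<lambda>z\<in>topspace (base C). geodesic_between (fiber C z) (u z) (v z) (real k / 2 ^ n)) \<in> cont_sections C"
proof (induction n arbitrary: k)
  note [simp] = field_geodesic[OF C] field_section_mem[OF C u] field_section_mem[OF C v]
  note ext = field_section_ext[OF C u] field_section_ext[OF C v]
  case 0
  have "(\<lambda>z\<in>topspace (base C). geodesic_between (fiber C z) (u z) (v z) 0) = u"
    "(\<lambda>z\<in>topspace (base C). geodesic_between (fiber C z) (u z) (v z) 1) = v"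
    using ext by (auto simp: fun_eq_iff restrict_def)
  moreover have "k = 0 \<or> k = 1" using 0 by auto
  ultimately show ?case using u v by (elim disjE) simp_all
next
  note [simp] = field_geodesic[OF C] field_section_mem[OF C u] field_section_mem[OF C v]
  case (Suc n)
  show ?case
  proof (cases "even k")
    case True
    then obtain j where "k = 2 * j" by blast
    then show ?thesis using Suc by simp
  next
    case False
    then obtain j where j: "k = 2 * j + 1" by (rule oddE)
    let ?a = "real j / 2 ^ n" and ?b = "real (Suc j) / 2 ^ n" and ?m = "real k / 2 ^ Suc n"
    have jn: "Suc j \<le> 2 ^ n" using Suc.prems j by auto
    then have ab: "?a \<in> {0..1}" "?b \<in> {0..1}" by (auto intro!: dyadic_in_unit simp del: of_nat_Suc)
    have m: "?m = (?a + ?b) / 2" by (simp add: j field_simps)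
    have m01: "?m \<in> {0..1}" by (rule dyadic_in_unit[OF Suc.prems])
    have "\<bar>a - (a + b) / 2\<bar> = \<bar>a - b\<bar> / 2 \<and> \<bar>(a + b) / 2 - b\<bar> = \<bar>a - b\<bar> / 2" for a b :: real
      by (auto simp: abs_if field_simps)
    then have diff: "\<bar>?a - ?m\<bar> = \<bar>?a - ?b\<bar> / 2" "\<bar>?m - ?b\<bar> = \<bar>?a - ?b\<bar> / 2"
      unfolding m by blast+
    show ?thesis
    proof (rule field_midpoint_closed[OF C Suc.IH[of j] Suc.IH[OF jn]])
      show "(\<lambda>z\<in>topspace (base C). geodesic_between (fiber C z) (u z) (v z) ?m)
          \<in> all_sections (base C) (fiber C)"
        unfolding all_sections_def restrict_PiE_iff by (intro ballI geodesic_between_mem m01) simp_all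
      fix z assume z: "z \<in> topspace (base C)"
      show "is_midpoint (fiber C z) ((\<lambda>z\<in>topspace (base C). geodesic_between (fiber C z) (u z) (v z) ?a) z)
         ((\<lambda>z\<in>topspace (base C). geodesic_between (fiber C z) (u z) (v z) ?b) z)
         ((\<lambda>z\<in>topspace (base C). geodesic_between (fiber C z) (u z) (v z) ?m) z)"
        unfolding is_midpoint_def using z ab m01 diff
        by (simp add: geodesic_between_dist del: power_Suc of_nat_Suc)
    qed (use jn in simp)
  qed
qed

lemma dyadic_approx:
  fixes r :: real assumes r: "r \<in> {0..1}" and e: "0 < e"
  obtains k n where "k \<le> 2 ^ n" "\<bar>real k / 2 ^ n - r\<bar> < e"
proof -
  obtain n where n: "(1 / 2 :: real) ^ n < e" using real_arch_pow_inv[OF e, of "1/2"] by auto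
  define k where "k = nat \<lfloor>r * 2 ^ n\<rfloor>"
  have k: "real k \<le> r * 2 ^ n" "r * 2 ^ n < real k + 1"
    using r by (auto simp: k_def of_nat_nat)
  have "r * 2 ^ n \<le> 1 * 2 ^ n" using r by (intro mult_right_mono) auto
  then have "real k \<le> 2 ^ n" using k(1) by linarith
  then have "k \<le> 2 ^ n" by (metis of_nat_le_iff of_nat_numeral of_nat_power)
  moreover have "\<bar>real k / 2 ^ n - r\<bar> \<le> (1 / 2) ^ n"
  proof -
    have "real k / 2 ^ n \<le> r" "r < (real k + 1) / 2 ^ n"
      using k by (simp_all add: divide_le_eq less_divide_eq)
    then show ?thesis by (simp add: add_divide_distrib power_one_over)
  qed
  ultimately show thesis using that n by force
qed

text \<open>For a dyadic parameter \<open>q\<close> the distance is continuous in \<open>y\<close>.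
  Replacing \<open>h y\<close> by \<open>q\<close> costs at most \<open>|h y - q|\<close> times the
  length \<open>l y\<close> of the geodesic, which is locally bounded as the distance of two
  continuous sections.\<close>

lemma continuous_geodesic_dist:
  assumes C: "continuous_field C"
    and u: "u \<in> cont_sections C" and v: "v \<in> cont_sections C" and w: "w \<in> cont_sections C"
    and p: "continuous_map Y (base C) p" and h: "continuous_map Y euclideanreal h"
    and h01: "\<And>y. y \<in> topspace Y \<Longrightarrow> h y \<in> {0..1}"
  shows "continuous_map Y euclideanreal
    (\<lambda>y. mdist (fiber C (p y)) (geodesic_between (fiber C (p y)) (u (p y)) (v (p y)) (h y)) (w (p y)))"
    (is "continuous_map Y euclideanreal (\<lambda>y. ?F y (h y))")
  unfolding continuous_map_euclideanreal_iff
proof (intro ballI allI impI)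
  fix y0 and e :: real assume y0: "y0 \<in> topspace Y" and e: "0 < e"
  have pm: "p y \<in> topspace (base C)" if "y \<in> topspace Y" for y
    using continuous_map_funspace[OF p] that by auto
  note mem = field_section_mem[OF C u] field_section_mem[OF C v] field_section_mem[OF C w]
  define l where "l y = mdist (fiber C (p y)) (u (p y)) (v (p y))" for y
  \<comment> \<open>Near \<open>y0\<close> the lengths stay below \<open>l y0 + 1\<close>; a
    parameter error of \<open>e / (3 * L)\<close> then costs at most \<open>e / 3\<close>.\<close>
  define L where "L = l y0 + 1"
  have L: "L > 0" by (simp add: L_def l_def add_nonneg_pos)
  define \<delta> where "\<delta> = e / (3 * L)"
  have \<delta>: "\<delta> > 0" using e L by (simp add: \<delta>_def)
  obtain k n where kn: "k \<le> 2 ^ n" "\<bar>real k / 2 ^ n - h y0\<bar> < \<delta>"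
    using dyadic_approx[OF h01[OF y0] \<delta>] by blast
  define q where "q = real k / 2 ^ n"
  have q01: "q \<in> {0..1}" unfolding q_def by (rule dyadic_in_unit[OF kn(1)])
  have Fq: "continuous_map Y euclideanreal (\<lambda>y. ?F y q)"
    using continuous_map_compose[OF p field_dist_continuous[OF C dyadic_geodesic_section[OF C u v kn(1)] w]]
    by (rule continuous_map_eq) (simp add: q_def pm)
  have lc: "continuous_map Y euclideanreal l"
    using continuous_map_compose[OF p field_dist_continuous[OF C u v]]
    by (rule continuous_map_eq) (simp add: l_def)
  have lip: "\<bar>?F y r - ?F y q\<bar> \<le> \<bar>r - q\<bar> * l y" if y: "y \<in> topspace Y" "r \<in> {0..1}" for y r
  proof -
    let ?X = "fiber C (p y)"
    let ?g = "geodesic_between ?X (u (p y)) (v (p y))"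
    have g: "?g s \<in> mspace ?X" if "s \<in> {0..1}" for s
      using mem pm[OF y(1)] that by (intro geodesic_between_mem field_geodesic[OF C])
    have "mdist ?X (?g r) (?g q) = \<bar>r - q\<bar> * l y"
      unfolding l_def using mem pm[OF y(1)] y(2) q01
      by (intro geodesic_between_dist field_geodesic[OF C])
    moreover have wm: "w (p y) \<in> mspace ?X" using mem pm[OF y(1)] by simp
    ultimately show ?thesis
      using mdist_triangle[OF g[OF y(2)] g[OF q01] wm] mdist_triangle[OF g[OF q01] g[OF y(2)] wm]
        mdist_commute[of ?X "?g r" "?g q"] by (simp add: abs_le_iff)
  qed
  obtain U1 where U1: "openin Y U1" "y0 \<in> U1" "\<And>y. y \<in> U1 \<Longrightarrow> \<bar>?F y0 q - ?F y q\<bar> < e / 3"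
    using continuous_map_euclideanrealD[OF Fq y0, of "e / 3"] e by auto
  obtain U2 where U2: "openin Y U2" "y0 \<in> U2" "\<And>y. y \<in> U2 \<Longrightarrow> \<bar>l y0 - l y\<bar> < 1"
    using continuous_map_euclideanrealD[OF lc y0, of 1] by auto
  obtain U3 where U3: "openin Y U3" "y0 \<in> U3" "\<And>y. y \<in> U3 \<Longrightarrow> \<bar>h y0 - h y\<bar> < \<delta> - \<bar>q - h y0\<bar>"
    using continuous_map_euclideanrealD[OF h y0, of "\<delta> - \<bar>q - h y0\<bar>"] kn(2) by (auto simp: q_def)
  have near: "\<bar>?F y (h y) - ?F y q\<bar> \<le> e / 3"
    if "y \<in> topspace Y" "\<bar>h y - q\<bar> < \<delta>" "l y \<le> L" for y
  proof -
    have "\<bar>h y - q\<bar> * l y \<le> \<delta> * L" using that \<delta> by (intro mult_mono) (auto simp: l_def)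
    also have "\<delta> * L = e / 3" using L by (simp add: \<delta>_def)
    finally show ?thesis using lip[OF that(1) h01[OF that(1)]] by linarith
  qed
  have "\<bar>?F y0 (h y0) - ?F y (h y)\<bar> < e" if y: "y \<in> U1 \<inter> U2 \<inter> U3" for y
  proof -
    have yY: "y \<in> topspace Y" using y openin_subset[OF U1(1)] by auto
    have "\<bar>?F y (h y) - ?F y q\<bar> \<le> e / 3"
      using U2(3)[of y] U3(3)[of y] y by (intro near[OF yY]) (auto simp: L_def)
    moreover have "\<bar>?F y0 (h y0) - ?F y0 q\<bar> \<le> e / 3"
      using kn(2) by (intro near[OF y0]) (auto simp: L_def q_def)
    moreover have "\<bar>?F y0 q - ?F y q\<bar> < e / 3" using U1(3) y by blast
    ultimately show ?thesis by linarith
  qed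
  then show "\<exists>U. openin Y U \<and> y0 \<in> U \<and> (\<forall>y\<in>U. \<bar>?F y0 (h y0) - ?F y (h y)\<bar> < e)"
    using U1 U2 U3 by (intro exI[of _ "U1 \<inter> U2 \<inter> U3"]) auto
qed

text \<open>The path is at \<open>b k\<close> at time \<open>k\<close> for \<open>k \<le> n\<close>
  and rests at its end points before time \<open>0\<close> and after time \<open>n\<close>. All real
  times are allowed because continuous functions approximating an integer valued one may leave
  \<open>[0, n]\<close>.\<close>

primrec geodesic_chain :: "'a metric \<Rightarrow> (nat \<Rightarrow> 'a) \<Rightarrow> nat \<Rightarrow> real \<Rightarrow> 'a" where
  "geodesic_chain X b 0 r = b 0"
| "geodesic_chain X b (Suc n) r =
     (if r \<le> real n then geodesic_chain X b n r
      else geodesic_between X (b n) (b (Suc n)) (max 0 (min 1 (r - real n))))"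

context
  fixes X :: "'a metric" and b :: "nat \<Rightarrow> 'a"
  assumes geo: "geodesic_space X" and b: "\<And>k. b k \<in> mspace X"
begin

lemma geodesic_chain_mem: "geodesic_chain X b n r \<in> mspace X"
  by (induction n) (auto intro!: geodesic_between_mem geo b)

lemma geodesic_chain_end: "real n \<le> r \<Longrightarrow> geodesic_chain X b n r = b n"
  by (induction n) (auto simp: geo b)

lemma geodesic_chain_nat: "k \<le> n \<Longrightarrow> geodesic_chain X b n (real k) = b k"
proof (induction n)
  case (Suc n)
  then show ?case using geodesic_chain_end[of "Suc n" "real k"] by (cases "k = Suc n") auto
qed simp

lemma geodesic_chain_bounded: "\<exists>B. \<forall>r. mdist X (geodesic_chain X b n r) (b 0) \<le> B"
proof (induction n)
  case 0
  then show ?case by auto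
next
  case (Suc n)
  then obtain B where B: "\<And>r. mdist X (geodesic_chain X b n r) (b 0) \<le> B" by blast
  let ?B = "mdist X (b n) (b (Suc n)) + mdist X (b n) (b 0)"
  have "mdist X (geodesic_between X (b n) (b (Suc n)) s) (b 0) \<le> ?B" if s: "s \<in> {0..1}" for s
  proof -
    have "mdist X (geodesic_between X (b n) (b (Suc n)) s) (geodesic_between X (b n) (b (Suc n)) 0)
        = \<bar>s - 0\<bar> * mdist X (b n) (b (Suc n))"
      using s by (intro geodesic_between_dist geo b) auto
    also have "\<dots> \<le> 1 * mdist X (b n) (b (Suc n))" using s by (intro mult_right_mono) auto
    finally have "mdist X (geodesic_between X (b n) (b (Suc n)) s) (b n) \<le> mdist X (b n) (b (Suc n))"
      by (simp add: geo b)
    moreover have "mdist X (geodesic_between X (b n) (b (Suc n)) s) (b 0)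
        \<le> mdist X (geodesic_between X (b n) (b (Suc n)) s) (b n) + mdist X (b n) (b 0)"
      by (intro mdist_triangle geodesic_between_mem geo b s)
    ultimately show ?thesis by linarith
  qed
  then have "mdist X (geodesic_chain X b (Suc n) r) (b 0) \<le> max B ?B" for r
    using B[of r] by (auto simp: le_max_iff_disj)
  then show ?case by blast
qed

end

text \<open>The two branches are pasted along the closed sets \<open>h \<le> n\<close> and
  \<open>h \<ge> n\<close>, and both pass through \<open>b n\<close> where \<open>h = n\<close>. The
  general \<open>p\<close> and \<open>h\<close> cover two uses: the projections of the product, for
  path sections, and a constant base point, for continuity within one fiber.\<close>

lemma continuous_chain_dist:
  assumes C: "continuous_field C" and b: "\<And>k. b k \<in> cont_sections C" and w: "w \<in> cont_sections C"
    and p: "continuous_map Y (base C) p" and h: "continuous_map Y euclideanreal h"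
  shows "continuous_map Y euclideanreal
    (\<lambda>y. mdist (fiber C (p y)) (geodesic_chain (fiber C (p y)) (\<lambda>k. b k (p y)) n (h y)) (w (p y)))"
proof (induction n)
  case 0
  show ?case
    using continuous_map_compose[OF p field_dist_continuous[OF C b[of 0] w]] by (simp add: o_def)
next
  case (Suc n)
  let ?G = "\<lambda>y. geodesic_between (fiber C (p y)) (b n (p y)) (b (Suc n) (p y)) (max 0 (min 1 (h y - real n)))"
  let ?F = "\<lambda>y. geodesic_chain (fiber C (p y)) (\<lambda>k. b k (p y)) n (h y)"
  have "continuous_map Y euclideanreal
    (\<lambda>y. if h y \<le> real n then mdist (fiber C (p y)) (?F y) (w (p y)) 
      else mdist (fiber C (p y)) (?G y) (w (p y)))"
  proof (rule continuous_map_cases_le[OF h])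
    show "continuous_map (subtopology Y {x \<in> topspace Y. real n \<le> h x}) euclideanreal
       (\<lambda>y. mdist (fiber C (p y)) (?G y) (w (p y)))"
      by (intro continuous_map_from_subtopology continuous_geodesic_dist[OF C b b w p]
          continuous_map_real_max continuous_map_real_min continuous_map_diff h) auto
    fix y assume y: "y \<in> topspace Y" "h y = real n"
    then have z: "p y \<in> topspace (base C)" using continuous_map_funspace[OF p] by auto
    show "mdist (fiber C (p y)) (?F y) (w (p y)) = mdist (fiber C (p y)) (?G y) (w (p y))"
      using y(2) field_geodesic[OF C z] field_section_mem[OF C b z]
      by (simp add: geodesic_chain_end)
  qed (auto intro: continuous_map_from_subtopology Suc.IH)
  then show ?case by (rule continuous_map_eq) simp
qed

lemma chain_section:
  assumes C: "continuous_field C" and b: "\<And>k. b k \<in> cont_sections C" and h: "continuous_on {0..1} h"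
  shows "(\<lambda>(z, t)\<in>topspace (base C) \<times> {0..1}. geodesic_chain (fiber C z) (\<lambda>k. b k z) n (h t))
    \<in> path_sections C"
  unfolding path_sections_iff[OF C]
proof (intro conjI ballI)
  show "(\<lambda>(z, t)\<in>topspace (base C) \<times> {0..1}. geodesic_chain (fiber C z) (\<lambda>k. b k z) n (h t))
    \<in> (\<Pi>\<^sub>E (z, t)\<in>topspace (base C) \<times> {0..1}. mspace (fiber C z))"
    using field_geodesic[OF C] field_section_mem[OF C b] by (auto intro!: geodesic_chain_mem)
  fix w assume w: "w \<in> cont_sections C"
  let ?Y = "prod_topology (base C) (top_of_set {0..1::real})"
  have "continuous_map ?Y euclideanreal (h \<circ> snd)"
    by (rule continuous_map_compose[OF continuous_map_snd]) (use h in simp)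
  from continuous_chain_dist[where n = n, OF C b w continuous_map_fst this]
  show "continuous_map ?Y euclideanreal
      (\<lambda>(z, t). mdist (fiber C z)
        ((\<lambda>(z, t)\<in>topspace (base C) \<times> {0..1}. geodesic_chain (fiber C z) (\<lambda>k. b k z) n (h t)) (z, t))
        (w z))"
    by (rule continuous_map_eq) auto
qed

section \<open>Paths of sections as square integrable functions, and their density\<close>

lemma path_section_dist_continuous:
  assumes C: "continuous_field C" and s: "s \<in> path_sections C" and u: "u \<in> cont_sections C"
    and z: "z \<in> topspace (base C)"
  shows "continuous_on {0..1} (\<lambda>t. mdist (fiber C z) (s (z, t)) (u z))"
proof -
  let ?Y = "prod_topology (base C) (top_of_set {0..1::real})"
  have "continuous_map (top_of_set {0..1}) (top_of_set {0..1::real}) (\<lambda>t. t)"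
    using continuous_map_id[of "top_of_set {0..1::real}"] by (simp add: id_def)
  then have "continuous_map (top_of_set {0..1}) ?Y (\<lambda>t. (z, t))"
    using z by (intro continuous_map_pairedI) simp_all
  moreover have "continuous_map ?Y euclideanreal (\<lambda>(z, t). mdist (fiber C z) (s (z, t)) (u z))"
    using s u unfolding path_sections_iff[OF C] by blast
  ultimately have "continuous_map (top_of_set {0..1}) euclideanreal
       ((\<lambda>(z, t). mdist (fiber C z) (s (z, t)) (u z)) \<circ> (\<lambda>t. (z, t)))"
    by (rule continuous_map_compose)
  then show ?thesis by (simp add: o_def)
qed

lemma second_countable_fiber:
  "\<lbrakk>second_countable_field C; z \<in> topspace (base C)\<rbrakk> \<Longrightarrow> second_countable (mtopology_of (fiber C z))"
  by (simp add: second_countable_field_def)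

text \<open>Distances to the values of continuous sections are continuous in \<open>t\<close>;
  density of these values gives measurability, and compactness of the unit interval gives
  boundedness.\<close>

lemma path_section_L2:
  assumes C: "continuous_field C" and sc: "second_countable_field C" and s: "s \<in> path_sections C"
    and z: "z \<in> topspace (base C)"
  shows "(\<lambda>t. s (z, t)) \<in> L2_functions (fiber C z)"
proof -
  obtain x where x: "x \<in> mspace (fiber C z)"
    using field_nonempty[OF C z] by blast
  obtain u where u: "u \<in> cont_sections C" by (rule field_dense[OF C z x zero_less_one])
  have "bounded ((\<lambda>t. mdist (fiber C z) (s (z, t)) (u z)) ` {0..1})"
    using path_section_dist_continuous[OF C s u z]
    by (rule compact_imp_bounded[OF compact_continuous_image]) simp
  then obtain B where "\<forall>t\<in>{0..1}. \<bar>mdist (fiber C z) (s (z, t)) (u z)\<bar> \<le> B"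
    unfolding bounded_real by auto
  then have B: "mdist (fiber C z) (s (z, t)) (u z) \<le> B" if "t \<in> {0..1}" for t
    using that by (simp add: abs_le_iff)
  show ?thesis
  proof (rule bounded_L2_functions[OF _ field_section_mem[OF C u z] B])
    show "(\<lambda>t. s (z, t)) \<in> measurable unit_lebesgue (metric_borel (fiber C z))"
    proof (rule measurable_metric_borelI[OF second_countable_fiber[OF sc z], of "(\<lambda>u. u z) ` cont_sections C"])
      fix c assume "c \<in> (\<lambda>u. u z) ` cont_sections C"
      then obtain u where u: "u \<in> cont_sections C" "c = u z" by blast
      show "(\<lambda>t. mdist (fiber C z) (s (z, t)) c) \<in> borel_measurable unit_lebesgue"
        unfolding u(2)
        using path_section_dist_continuous[OF C s u(1) z]
        by (rule continuous_imp_measurable_on_sets_lebesgue) simp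
    next
      show "(\<lambda>u. u z) ` cont_sections C \<subseteq> mspace (fiber C z)" using field_section_mem[OF C _ z] by auto
      show "\<exists>c\<in>(\<lambda>u. u z) ` cont_sections C. mdist (fiber C z) x c < e"
        if "x \<in> mspace (fiber C z)" "0 < e" for x e
        by (rule field_dense[OF C z that]) blast
      show "s (z, t) \<in> mspace (fiber C z)" if "t \<in> space unit_lebesgue" for t
        using path_section_mem[OF C s z] that by simp
    qed
  qed
qed

text \<open>\<open>\<iota> n t\<close> is the first index of a center nearest to
  \<open>\<xi> t\<close> among \<open>c 0, ..., c n\<close>. The error is dominated by the square
  integrable distance to \<open>c 0\<close> and tends to \<open>0\<close> by density. The bound on
  \<open>\<iota>\<close> fixes the length of the geodesic chain used afterwards.\<close>

lemma simple_approx: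
  assumes sc: "second_countable (mtopology_of X)" and \<xi>: "\<xi> \<in> L2_functions X"
    and c: "\<And>k. c k \<in> mspace X" and dense: "\<And>x e. x \<in> mspace X \<Longrightarrow> 0 < e \<Longrightarrow> \<exists>k::nat. mdist X x (c k) < e"
    and e: "0 < e"
  obtains \<iota> n where "\<iota> \<in> measurable unit_lebesgue (count_space UNIV)" "\<And>t. \<iota> t \<le> n"
    "(\<lambda>t. c (\<iota> t)) \<in> L2_functions X" "L2_dist X (\<lambda>t. c (\<iota> t)) \<xi> < e"
proof -
  define P where "P n t k \<longleftrightarrow> k \<le> n \<and> (\<forall>j\<in>{..n}. mdist X (\<xi> t) (c k) \<le> mdist X (\<xi> t) (c j))" for n t k
  define \<iota> where "\<iota> n t = (LEAST k. P n t k)" for n t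
  have "\<exists>k. P n t k" for n t
  proof -
    obtain k where "is_arg_min (\<lambda>j. mdist X (\<xi> t) (c j)) (\<lambda>j. j \<in> {..n}) k"
      using ex_is_arg_min_if_finite[of "{..n}" "\<lambda>j. mdist X (\<xi> t) (c j)"] by auto
    then show ?thesis unfolding P_def is_arg_min_linorder by auto
  qed
  then have \<iota>: "P n t (\<iota> n t)" for n t unfolding \<iota>_def by (metis LeastI_ex)
  have [measurable]: "(\<lambda>t. mdist X (\<xi> t) (c k)) \<in> borel_measurable unit_lebesgue" for k
    by (rule measurable_compose[OF L2_functions_measurable[OF \<xi>] measurable_mdist_const[OF c]])
  have \<iota>_meas: "\<iota> n \<in> measurable unit_lebesgue (count_space UNIV)" for n
    unfolding \<iota>_def P_def by measurable
  have L2: "(\<lambda>t. c (\<iota> n t)) \<in> L2_functions X" for n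
  proof (rule finite_range_L2_functions[OF \<iota>_meas])
    show "finite (\<iota> n ` {0..1})"
      by (rule finite_subset[of _ "{..n}"]) (use \<iota> in \<open>auto simp: P_def\<close>)
  qed (rule c)
  have \<xi>m: "\<xi> t \<in> mspace X" if "t \<in> {0..1}" for t
    using L2_functions_in_mspace[OF \<xi>] that by simp
  have "(\<lambda>n. L2_dist X (\<lambda>t. c (\<iota> n t)) \<xi>) \<longlonglongrightarrow> 0"
  proof (rule L2_dist_tendsto_0[OF sc \<xi> L2])
    have "(\<lambda>t. c 0) \<in> L2_functions X"
      by (rule bounded_L2_functions[of _ _ "c 0"]) (auto intro!: measurable_const c simp: c)
    then show "integrable unit_lebesgue (\<lambda>t. (mdist X (\<xi> t) (c 0))\<^sup>2)"
      by (rule integrable_mdist_L2[OF sc \<xi>])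
    show "mdist X (c (\<iota> n t)) (\<xi> t) \<le> mdist X (\<xi> t) (c 0)" for n t
      using \<iota>[of n t] by (simp add: P_def mdist_commute)
    show "AE t in unit_lebesgue. (\<lambda>n. mdist X (c (\<iota> n t)) (\<xi> t)) \<longlonglongrightarrow> 0"
    proof (rule AE_I2, rule LIMSEQ_I)
      fix t :: real and r :: real assume t: "t \<in> space unit_lebesgue" and r: "0 < r"
      then have "\<xi> t \<in> mspace X" using \<xi>m[of t] by simp
      then obtain k where k: "mdist X (\<xi> t) (c k) < r" using dense r by blast
      have "mdist X (c (\<iota> n t)) (\<xi> t) < r" if "n \<ge> k" for n
        using \<iota>[of n t] that k by (force simp: P_def mdist_commute)
      then show "\<exists>k. \<forall>n\<ge>k. norm (mdist X (c (\<iota> n t)) (\<xi> t) - 0) < r" by auto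
    qed
  qed
  then obtain n where n: "L2_dist X (\<lambda>t. c (\<iota> n t)) \<xi> < e"
    using e by (metis (no_types, lifting) eventually_sequentially order_refl order_tendstoD(2))
  have "\<iota> n t \<le> n" for t using \<iota>[of n t] by (simp add: P_def)
  from that[OF \<iota>_meas this L2 n] show thesis .
qed

lemma L2_dist_commute: "L2_dist X \<xi> \<eta> = L2_dist X \<eta> \<xi>"
  by (simp add: L2_dist_def mdist_commute)

lemma path_sections_dense:
  assumes C: "continuous_field C" and sc: "second_countable_field C" and z: "z \<in> topspace (base C)"
    and \<xi>: "\<xi> \<in> L2_functions (fiber C z)" and e: "0 < e"
  obtains s where "s \<in> path_sections C" "L2_dist (fiber C z) \<xi> (\<lambda>t. s (z, t)) < e"
proof -
  let ?X = "fiber C z"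
  note scX = second_countable_fiber[OF sc z]
  interpret L2: pseudometric_on "L2_functions ?X" "L2_dist ?X" by (rule pseudometric_L2[OF scX])
  have ne: "mspace ?X \<noteq> {}" by (rule field_nonempty[OF C z])
  obtain E where E: "countable E" "E \<subseteq> (\<lambda>u. u z) ` cont_sections C"
    "\<And>x e. x \<in> mspace ?X \<Longrightarrow> 0 < e \<Longrightarrow> \<exists>c\<in>E. mdist ?X x c < e"
  proof (rule countable_dense_subset[OF scX, of "(\<lambda>u. u z) ` cont_sections C"])
    show "(\<lambda>u. u z) ` cont_sections C \<subseteq> mspace ?X" using field_section_mem[OF C _ z] by auto
    show "\<exists>c\<in>(\<lambda>u. u z) ` cont_sections C. mdist ?X x c < e" if "x \<in> mspace ?X" "0 < e" for x e
      by (rule field_dense[OF C z that]) blast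
  qed (rule that)
  obtain x where "x \<in> mspace ?X" using ne by blast
  then have "E \<noteq> {}" using E(3)[of x 1] by auto
  have "from_nat_into E k \<in> (\<lambda>u. u z) ` cont_sections C" for k
    using E(2) from_nat_into[OF \<open>E \<noteq> {}\<close>] by blast
  then have "\<forall>k. \<exists>u\<in>cont_sections C. u z = from_nat_into E k" by (metis imageE)
  then obtain b where b: "\<And>k. b k \<in> cont_sections C" "\<And>k. b k z = from_nat_into E k" by metis
  have bz: "b k z \<in> mspace ?X" for k using field_section_mem[OF C b(1) z] .
  have bd: "\<exists>k. mdist ?X x (b k z) < e" if xe: "x \<in> mspace ?X" "0 < e" for x e
  proof -
    obtain y where y: "y \<in> E" "mdist ?X x y < e" using E(3)[OF xe] by blast
    moreover obtain k where "from_nat_into E k = y" using from_nat_into_surj[OF E(1) y(1)] by blast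
    ultimately show ?thesis using b(2) by metis
  qed
  obtain \<iota> n where \<iota>: "\<iota> \<in> measurable unit_lebesgue (count_space UNIV)" "\<And>t. \<iota> t \<le> n"
    "(\<lambda>t. b (\<iota> t) z) \<in> L2_functions ?X" "L2_dist ?X (\<lambda>t. b (\<iota> t) z) \<xi> < e / 2"
    by (rule simple_approx[OF scX \<xi> bz bd half_gt_zero[OF e]]) (assumption | rule that)+
  have "(\<lambda>t. real (\<iota> t)) \<in> borel_measurable unit_lebesgue"
    using \<iota>(1) by (rule measurable_compose) simp
  \<comment> \<open>Extended by zero to the line, the index function is Lebesgue measurable and
    hence an almost everywhere limit of continuous functions; \<open>measurable_on\<close> supplies
    these as \<open>g j\<close>.\<close>
  then have "(\<lambda>t. if t \<in> {0..1} then real (\<iota> t) else 0) \<in> borel_measurable lebesgue"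
    by (subst borel_measurable_if) auto
  then have "(\<lambda>t. if t \<in> {0..1} then real (\<iota> t) else 0) measurable_on {0..1}"
    by (rule lebesgue_measurable_imp_measurable_on_real) simp
  then obtain N g where N: "negligible N" and g: "\<And>j. continuous_on UNIV (g j)"
    and g_lim: "\<And>t. t \<notin> N \<Longrightarrow>
      (\<lambda>j. g j t) \<longlonglongrightarrow> (if t \<in> {0..1} then (if t \<in> {0..1} then real (\<iota> t) else 0) else 0)"
    unfolding measurable_on_def by blast
  have g_lim: "(\<lambda>j. g j t) \<longlonglongrightarrow> real (\<iota> t)" if "t \<in> {0..1}" "t \<notin> N" for t
    using g_lim[OF that(2)] that(1) by simp
  let ?ch = "geodesic_chain ?X (\<lambda>k. b k z) n"
  define s where "s j =
      (\<lambda>(z, t)\<in>topspace (base C) \<times> {0..1}. geodesic_chain (fiber C z) (\<lambda>k. b k z) n (g j t))" for j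
  have s: "s j \<in> path_sections C" for j
    unfolding s_def by (intro chain_section C b continuous_on_subset[OF g]) simp
  have sz: "s j (z, t) = ?ch (g j t)" if "t \<in> {0..1}" for j t using that z by (simp add: s_def)
  have chn: "?ch (real (\<iota> t)) = b (\<iota> t) z" for t
    by (rule geodesic_chain_nat[OF field_geodesic[OF C z] bz \<iota>(2)])
  have chm: "?ch r \<in> mspace ?X" for r by (rule geodesic_chain_mem[OF field_geodesic[OF C z] bz])
  obtain B where B: "\<And>r. mdist ?X (?ch r) (b 0 z) \<le> B"
    using geodesic_chain_bounded[of ?X "\<lambda>k. b k z" n, OF field_geodesic[OF C z] bz] by blast
  have ch_cont: "isCont (\<lambda>r. mdist ?X (?ch r) (b k z)) r0" for k r0
  proof -
    have "continuous_map euclideanreal euclideanreal (\<lambda>r. mdist ?X (?ch r) (b k z))"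
      by (rule continuous_chain_dist[OF C b(1) b(1), of _ "\<lambda>_. z" "\<lambda>r. r"]) (use z in auto)
    then show ?thesis by (simp add: continuous_on_eq_continuous_at)
  qed
  \<comment> \<open>Almost everywhere \<open>g j t\<close> tends to the integer time at which the
    chain is at \<open>b (\<iota> t) z\<close>. All points of the chain are within \<open>B\<close>
    of \<open>b 0 z\<close>, so \<open>2 * B\<close> dominates.\<close>
  have "(\<lambda>j. L2_dist ?X (\<lambda>t. s j (z, t)) (\<lambda>t. b (\<iota> t) z)) \<longlonglongrightarrow> 0"
  proof (rule L2_dist_tendsto_0[OF scX \<iota>(3) path_section_L2[OF C sc s z]])
    interpret finite_measure unit_lebesgue by (rule finite_measure_unit_lebesgue)
    show "integrable unit_lebesgue (\<lambda>t. (2 * B)\<^sup>2)" by simp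
    show "mdist ?X (s j (z, t)) (b (\<iota> t) z) \<le> 2 * B" if t: "t \<in> {0..1}" for j t
      using mdist_triangle[OF chm[of "g j t"] bz[of 0] chm[of "real (\<iota> t)"]]
        B[of "g j t"] B[of "real (\<iota> t)"] mdist_commute[of ?X "b 0 z"]
      by (simp add: sz[OF t] chn)
    have "AE t in unit_lebesgue. t \<notin> N"
      by (rule AE_unit_lebesgue_negligible[OF N])
    then show "AE t in unit_lebesgue. (\<lambda>j. mdist ?X (s j (z, t)) (b (\<iota> t) z)) \<longlonglongrightarrow> 0"
    proof (rule AE_mp, intro AE_I2 impI)
      fix t :: real assume "t \<in> space unit_lebesgue" and tN: "t \<notin> N"
      then have t: "t \<in> {0..1}" by simp
      have "(\<lambda>j. mdist ?X (?ch (g j t)) (b (\<iota> t) z)) \<longlonglongrightarrow> mdist ?X (?ch (real (\<iota> t))) (b (\<iota> t) z)"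
        using isCont_tendsto_compose[OF ch_cont g_lim[OF t tN]] .
      then show "(\<lambda>j. mdist ?X (s j (z, t)) (b (\<iota> t) z)) \<longlonglongrightarrow> 0" by (simp add: sz[OF t] chn bz)
    qed
  qed
  from eventually_happens'[OF sequentially_bot order_tendstoD(2)[OF this half_gt_zero[OF e]]]
  obtain j where j: "L2_dist ?X (\<lambda>t. s j (z, t)) (\<lambda>t. b (\<iota> t) z) < e / 2" ..
  have "L2_dist ?X \<xi> (\<lambda>t. s j (z, t)) < e"
    using L2.triangle[OF \<xi> \<iota>(3) path_section_L2[OF C sc s z, of j]] j \<iota>(4)
      L2_dist_commute[of ?X \<xi> "\<lambda>t. b (\<iota> t) z"]
      L2_dist_commute[of ?X "\<lambda>t. s j (z, t)" "\<lambda>t. b (\<iota> t) z"] by linarith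
  then show thesis using that s by blast
qed

section \<open>The randomization\<close>

text \<open>Of the continuous sections of the randomization only necessary conditions are extracted:
  an isomorphism has to send given sections to sections of the constant field, so membership in the
  randomization never has to be established.\<close>

lemma
  assumes C: "continuous_field C" and sc: "second_countable_field C"
  shows base_randomization: "base (randomization C) = base C"
    and fiber_randomization: "z \<in> topspace (base C) \<Longrightarrow> fiber (randomization C) z = L2_space (fiber C z)"
    and randomization_section_mem: "\<lbrakk>\<sigma> \<in> cont_sections (randomization C); z \<in> topspace (base C)\<rbrakk>
      \<Longrightarrow> \<sigma> z \<in> mspace (L2_space (fiber C z))"
    and randomization_section_continuous: "\<lbrakk>\<sigma> \<in> cont_sections (randomization C); s \<in> path_sections C\<rbrakk>
      \<Longrightarrow> continuous_map (base C) euclideanreal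
           (\<lambda>z. mdist (L2_space (fiber C z)) (\<sigma> z) (ae_equal (fiber C z) `` {\<lambda>t. s (z, t)}))"
proof -
  let ?c = "\<lambda>s z. ae_equal (fiber C z) `` {\<lambda>t. s (z, t)}"
  let ?\<Sigma> = "(\<lambda>s. \<lambda>z\<in>topspace (base C). ?c s z) ` path_sections C"
  have im: "(\<lambda>s. s z) ` ?\<Sigma> = (\<lambda>s. ?c s z) ` path_sections C" if "z \<in> topspace (base C)" for z
    using that by (auto simp: image_image)
  have closure: "mtopology_of (L2_space (fiber C z)) closure_of ((\<lambda>s. ?c s z) ` path_sections C)
      = mspace (L2_space (fiber C z))" (is "?L = ?R") if z: "z \<in> topspace (base C)" for z
  proof
    note scz = second_countable_fiber[OF sc z]
    show "?L \<subseteq> ?R" using closure_of_subset_topspace[of "mtopology_of (L2_space (fiber C z))"] by simp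
    show "?R \<subseteq> ?L"
    proof
      fix P assume P: "P \<in> ?R"
      then obtain \<xi> where \<xi>: "\<xi> \<in> L2_functions (fiber C z)" "P = ae_equal (fiber C z) `` {\<xi>}"
        by (rule L2_space_cases[OF scz])
      show "P \<in> ?L"
      proof (rule metric_closureI[OF P])
        fix e :: real assume "0 < e"
        then obtain s where s: "s \<in> path_sections C" "L2_dist (fiber C z) \<xi> (\<lambda>t. s (z, t)) < e"
          by (rule path_sections_dense[OF C sc z \<xi>(1)])
        note sL = path_section_L2[OF C sc s(1) z]
        have "mdist (L2_space (fiber C z)) P (?c s z) < e"
          using s(2) by (simp add: \<xi>(2) mdist_L2_space[OF scz \<xi>(1) sL])
        then show "\<exists>y\<in>(\<lambda>s. ?c s z) ` path_sections C. y \<in> mspace (L2_space (fiber C z)) \<and>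
            mdist (L2_space (fiber C z)) P y < e"
          using s(1) L2_class_mem[OF scz sL] by blast
      qed
    qed
  qed
  show "base (randomization C) = base C"
    by (simp add: randomization_def generated_field_def Let_def)
  show fib: "fiber (randomization C) z = L2_space (fiber C z)" if z: "z \<in> topspace (base C)" for z
    by (simp add: randomization_def generated_field_def Let_def im[OF z] closure[OF z])
  have cs: "cont_sections (randomization C) =
      {\<sigma> \<in> all_sections (base C) (fiber (randomization C)).
        \<forall>s'\<in>?\<Sigma>. co_continuous (base C) (\<lambda>z. L2_space (fiber C z)) \<sigma> s'}"
    by (simp add: randomization_def generated_field_def Let_def)
  show "\<sigma> z \<in> mspace (L2_space (fiber C z))"
    if "\<sigma> \<in> cont_sections (randomization C)" "z \<in> topspace (base C)"
  proof -
    have "\<sigma> \<in> (\<Pi>\<^sub>E z\<in>topspace (base C). mspace (fiber (randomization C) z))"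
      using that(1) unfolding cs all_sections_def by blast
    then have "\<sigma> z \<in> mspace (fiber (randomization C) z)" using that(2) by (rule PiE_mem)
    then show ?thesis by (simp only: fib[OF that(2)])
  qed
  show "continuous_map (base C) euclideanreal (\<lambda>z. mdist (L2_space (fiber C z)) (\<sigma> z) (?c s z))"
    if "\<sigma> \<in> cont_sections (randomization C)" "s \<in> path_sections C"
  proof -
    have "co_continuous (base C) (\<lambda>z. L2_space (fiber C z)) \<sigma> (\<lambda>z\<in>topspace (base C). ?c s z)"
      using that unfolding cs by blast
    then show ?thesis unfolding co_continuous_def by (rule continuous_map_eq) simp
  qed
qed

section \<open>Local trivializations\<close>

text \<open>Triviality near \<open>x\<close> comes with a model \<open>X'\<close> and a base
  \<open>Z\<close> of its own. Inverting the homeomorphism \<open>g\<close> moves the base back to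
  \<open>U\<close>; composing with one fixed isometry, which does not affect continuity, moves the
  model to the fiber over \<open>z\<close>, common to all \<open>x\<close>.\<close>

lemma local_trivialization:
  fixes C :: "('z, 'a) metric_field" and X :: "'b metric"
  assumes C: "continuous_field C" and lt: "locally_trivial_field C"
    and iso: "\<And>z. z \<in> topspace (base C) \<Longrightarrow> \<exists>f. isometric_bij (fiber C z) X f"
    and z: "z \<in> topspace (base C)" and x: "x \<in> topspace (base C)"
  obtains U \<psi> where "openin (base C) U" "x \<in> U"
    "\<And>y. y \<in> U \<Longrightarrow> isometric_bij (fiber C y) (fiber C z) (\<psi> y)"
    "\<And>u. u \<in> cont_sections C \<Longrightarrow>
      continuous_map (subtopology (base C) U) (mtopology_of (fiber C z)) (\<lambda>y. \<psi> y (u y))"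
proof -
  obtain U where U: "openin (base C) U" "x \<in> U" "trivial_field (restrict_field C U)"
    using lt x unfolding locally_trivial_field_def by blast
  let ?U = "subtopology (base C) U"
  let ?R = "restrict_field C U"
  have US: "U \<subseteq> topspace (base C)" by (rule openin_subset[OF U(1)])
  then have topU: "topspace ?U = U" by auto
  have baseR: "base ?R = ?U"
    by (simp add: restrict_field_def pullback_field_def generated_field_def Let_def)
  have fibR: "fiber ?R y = fiber C y" if "y \<in> U" for y
    unfolding restrict_field_def using that US by (intro fiber_pullback[OF C]) auto
  have secR: "restrict u U \<in> cont_sections ?R" if u: "u \<in> cont_sections C" for u
  proof -
    have "continuous_map ?U euclideanreal (\<lambda>y. mdist (fiber C y) (restrict u U y) (v y))"
      if v: "v \<in> cont_sections C" for v
      using continuous_map_from_subtopology[OF field_dist_continuous[OF C u v], of U]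
      by (rule continuous_map_eq) simp
    moreover have "restrict u U \<in> all_sections ?U (fiber C)"
      unfolding all_sections_def topU restrict_PiE_iff using field_section_mem[OF C u] US by blast
    moreover have "cont_sections ?R = {s \<in> all_sections ?U (fiber C).
        \<forall>v\<in>cont_sections C. continuous_map ?U euclideanreal (\<lambda>y. mdist (fiber C y) (s y) (v y))}"
      unfolding restrict_field_def using US by (intro cont_sections_pullback[OF C]) auto
    ultimately show ?thesis by blast
  qed
  obtain Z :: "'z topology" and X' :: "'a metric" and g \<phi>
    where iso': "isometric_field_iso ?R (constant_field Z X') g \<phi>"
    using U(3) unfolding trivial_field_def by blast
  have "homeomorphic_map Z ?U g"
    using iso' by (simp add: isometric_field_iso_def constant_field_def baseR)
  then obtain g' where g': "homeomorphic_maps Z ?U g g'" unfolding homeomorphic_map_maps by blast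
  have "g' \<in> U \<rightarrow> topspace Z" "\<forall>y\<in>U. g (g' y) = y"
    using g' continuous_map_funspace[of ?U Z g'] unfolding homeomorphic_maps_def topU by blast+
  then have gg': "g' y \<in> topspace Z" "g (g' y) = y" if "y \<in> U" for y
    using that by auto
  have \<phi>: "isometric_bij (fiber C y) X' (\<phi> (g' y))" if "y \<in> U" for y
  proof -
    have "\<forall>w\<in>topspace Z. isometric_bij (fiber ?R (g w)) X' (\<phi> w)"
      using iso' by (simp add: isometric_field_iso_def constant_field_def)
    then have "isometric_bij (fiber ?R (g (g' y))) X' (\<phi> (g' y))" using gg'[OF that] by blast
    then show ?thesis by (simp add: gg'[OF that] fibR[OF that])
  qed
  obtain f1 where f1: "isometric_bij (fiber C x) X f1" using iso[OF x] by blast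
  obtain f2 where f2: "isometric_bij (fiber C z) X f2" using iso[OF z] by blast
  \<comment> \<open>The composite runs from \<open>X'\<close> to the fiber over \<open>x\<close>, on
    to \<open>X\<close>, and back to the fiber over \<open>z\<close>.\<close>
  obtain \<kappa> where \<kappa>: "isometric_bij X' (fiber C z) \<kappa>"
    using isometric_bij_comp[OF isometric_bij_comp[OF isometric_bij_inv[OF \<phi>[OF U(2)]] f1]
      isometric_bij_inv[OF f2]]
    by blast
  show thesis
  proof (rule that[OF U(1,2)])
    show "isometric_bij (fiber C y) (fiber C z) ((\<kappa> \<circ> \<phi> (g' y)))" if "y \<in> U" for y
      by (rule isometric_bij_comp[OF \<phi>[OF that] \<kappa>])
    fix u assume u: "u \<in> cont_sections C"
    have "(\<lambda>w\<in>topspace Z. \<phi> w (restrict u U (g w))) \<in> cont_sections (constant_field Z X')"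
    proof -
      have "base (constant_field Z X') = Z" by (simp add: constant_field_def)
      then show ?thesis using iso' secR[OF u] unfolding isometric_field_iso_def by metis
    qed
    then have "continuous_map Z (mtopology_of X') (\<lambda>w\<in>topspace Z. \<phi> w (restrict u U (g w)))"
      by (simp add: constant_field_def)
    moreover have "continuous_map ?U Z g'" using g' by (simp add: homeomorphic_maps_def)
    ultimately have "continuous_map ?U (mtopology_of (fiber C z))
        (\<kappa> \<circ> ((\<lambda>w\<in>topspace Z. \<phi> w (restrict u U (g w))) \<circ> g'))"
      using continuous_map_isometric_bij[OF \<kappa>] by (blast intro: continuous_map_compose)
    then show "continuous_map ?U (mtopology_of (fiber C z)) (\<lambda>y. (\<kappa> \<circ> \<phi> (g' y)) (u y))"
      by (rule continuous_map_eq) (simp add: gg' topU)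
  qed
qed

text \<open>The function of index \<open>n\<close> being negative outside \<open>U (p n)\<close> rather than vanishing there keeps
  its nonnegativity set, which is closed, inside \<open>U (p n)\<close>. Only so
  are the glued sections bounded near the boundary of \<open>U (p n)\<close>.\<close>

lemma countable_cover_functions:
  assumes sc: "second_countable Z" and lc: "locally_compact_space Z" and H: "Hausdorff_space Z"
    and ne: "topspace Z \<noteq> {}"
    and U: "\<And>z. z \<in> topspace Z \<Longrightarrow> openin Z (U z) \<and> z \<in> U z"
  obtains p :: "nat \<Rightarrow> 'z" and f :: "nat \<Rightarrow> 'z \<Rightarrow> real"
  where "\<And>n. p n \<in> topspace Z" "\<And>n. continuous_map Z euclideanreal (f n)"
    "\<And>n z. z \<in> topspace Z \<Longrightarrow> 0 \<le> f n z \<Longrightarrow> z \<in> U (p n)"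
    "\<And>z. z \<in> topspace Z \<Longrightarrow> \<exists>n. 1 < f n z"
proof -
  have cr: "completely_regular_space Z"
    by (rule locally_compact_regular_imp_completely_regular_space[OF lc]) (use H in simp)
  have "\<forall>z\<in>topspace Z. \<exists>g. continuous_map Z euclideanreal g \<and> 1 < g z \<and>
      (\<forall>y\<in>topspace Z. 0 \<le> g y \<longrightarrow> y \<in> U z)"
  proof
    fix z assume z: "z \<in> topspace Z"
    have "closedin Z (topspace Z - U z) \<and> z \<in> topspace Z - (topspace Z - U z)"
      using U[OF z] z by auto
    from cr[unfolded completely_regular_space_def, rule_format, OF this]
    obtain h :: "'z \<Rightarrow> real" where h: "continuous_map Z (top_of_set {0..1}) h" "h z = 0"
      "h ` (topspace Z - U z) \<subseteq> {1}" by blast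
    have "continuous_map Z euclideanreal h" by (rule continuous_map_into_fulltopology[OF h(1)])
    \<comment> \<open>The affine change gives \<open>2\<close> at \<open>z\<close>, where
      \<open>h\<close> is \<open>0\<close>, and \<open>-1\<close> outside \<open>U z\<close>, where
      \<open>h\<close> is \<open>1\<close>, so the thresholds \<open>1\<close> and \<open>0\<close>
      are both passed strictly.\<close>
    then have "continuous_map Z euclideanreal (\<lambda>y. 2 - 3 * h y)"
      by (intro continuous_map_diff continuous_map_real_mult continuous_map_canonical_const)
    moreover have "y \<in> U z" if y: "y \<in> topspace Z" "0 \<le> 2 - 3 * h y" for y
    proof (rule ccontr)
      assume "y \<notin> U z"
      then have "h y = 1" using h(3) y(1) by blast
      then show False using y(2) by simp
    qed
    ultimately show "\<exists>g. continuous_map Z euclideanreal g \<and> 1 < g z \<and>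
        (\<forall>y\<in>topspace Z. 0 \<le> g y \<longrightarrow> y \<in> U z)"
      using h(2) by (intro exI[of _ "\<lambda>y. 2 - 3 * h y"]) simp
  qed
  from bchoice[OF this] obtain g where g: "\<And>z. z \<in> topspace Z \<Longrightarrow> continuous_map Z euclideanreal (g z)"
    "\<And>z. z \<in> topspace Z \<Longrightarrow> 1 < g z z"
    "\<And>z y. z \<in> topspace Z \<Longrightarrow> y \<in> topspace Z \<Longrightarrow> 0 \<le> g z y \<Longrightarrow> y \<in> U z"
    by blast
  define W where "W z = {y \<in> topspace Z. g z y \<in> {1<..}}" for z
  have W: "openin Z (W z)" if "z \<in> topspace Z" for z
    unfolding W_def by (rule openin_continuous_map_preimage[OF g(1)[OF that]]) simp
  have "\<Union> (W ` topspace Z) = topspace Z" using g(2) by (auto simp: W_def)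
  then have "\<exists>\<V>. countable \<V> \<and> \<V> \<subseteq> W ` topspace Z \<and> \<Union>\<V> = topspace Z"
    by (intro Lindelof_spaceD[OF second_countable_imp_Lindelof_space[OF sc]]) (auto simp: W)
  then obtain \<V> where \<V>: "countable \<V> \<and> \<V> \<subseteq> W ` topspace Z \<and> \<Union>\<V> = topspace Z" ..
  then have "countable \<V> \<and> \<V> \<subseteq> W ` topspace Z" by (elim conjE) (rule conjI)
  from this[unfolded countable_subset_image]
  obtain T where T: "countable T \<and> T \<subseteq> topspace Z \<and> \<V> = W ` T" ..
  have \<V>: "\<Union>\<V> = topspace Z" using \<V> by (elim conjE)
  have T: "countable T" "T \<subseteq> topspace Z" "\<V> = W ` T" using T by simp_all
  have "T \<noteq> {}"
  proof
    assume "T = {}"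
    then have "\<Union>\<V> = {}" by (simp add: T(3))
    then show False using ne \<V> by metis
  qed
  let ?p = "from_nat_into T"
  have pT: "?p n \<in> topspace Z" for n using from_nat_into[OF \<open>T \<noteq> {}\<close>] T(2) by blast
  show thesis
  proof (rule that[of ?p "\<lambda>n. g (?p n)"])
    fix z assume "z \<in> topspace Z"
    then obtain t where "t \<in> T" "1 < g t z" using \<V> T(3) by (auto simp: W_def)
    moreover obtain n where "?p n = t" using from_nat_into_surj[OF T(1) \<open>t \<in> T\<close>] by blast
    ultimately show "\<exists>n. 1 < g (?p n) z" by blast
  qed (use pT g in auto)
qed

text \<open>Dominated convergence concerns sequences. If the claim failed, every member of a
  countable decreasing neighborhood base at \<open>z\<close> would contain a point whose integral
  has absolute value at least \<open>e\<close>, and these points converge to \<open>z\<close>. In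
  \<open>lim\<close> the neighborhood may depend on \<open>t\<close>, but one null set of
  exceptional \<open>t\<close> serves all \<open>e\<close>.\<close>

lemma integral_dominated_convergence_first_countable:
  fixes F :: "'z \<Rightarrow> real \<Rightarrow> real"
  assumes fc: "first_countable Z" and V: "openin Z V" "z \<in> V"
    and meas: "\<And>y. y \<in> V \<Longrightarrow> F y \<in> borel_measurable unit_lebesgue"
    and bound: "\<And>y t. y \<in> V \<Longrightarrow> t \<in> {0..1} \<Longrightarrow> \<bar>F y t\<bar> \<le> B"
    and lim: "AE t in unit_lebesgue. \<forall>e>0. \<exists>W. openin Z W \<and> z \<in> W \<and> (\<forall>y\<in>W. \<bar>F y t\<bar> < e)"
    and e: "0 < e"
  shows "\<exists>W. openin Z W \<and> z \<in> W \<and> (\<forall>y\<in>W. \<bar>LINT t|unit_lebesgue. F y t\<bar> < e)"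
proof (rule ccontr)
  assume neg: "\<nexists>W. openin Z W \<and> z \<in> W \<and> (\<forall>y\<in>W. \<bar>LINT t|unit_lebesgue. F y t\<bar> < e)"
  have z: "z \<in> topspace Z" using V openin_subset by blast
  obtain \<B> where \<B>: "countable \<B>" "\<And>U. U \<in> \<B> \<Longrightarrow> openin Z U"
    "\<And>U. openin Z U \<Longrightarrow> z \<in> U \<Longrightarrow> \<exists>W\<in>\<B>. z \<in> W \<and> W \<subseteq> U"
    using fc z unfolding first_countable_def by metis
  define \<A> where "\<A> = {W \<in> \<B>. z \<in> W}"
  have cA: "countable \<A>" using \<B>(1) by (simp add: \<A>_def)
  have neA: "\<A> \<noteq> {}" using \<B>(3)[OF V] by (auto simp: \<A>_def)
  \<comment> \<open>Intersecting initial segments of the base makes the sequence eventually stay in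
    each neighborhood; intersecting with \<open>V\<close> keeps the integrands bounded and
    measurable.\<close>
  define A where "A n = V \<inter> (\<Inter>k\<le>n. from_nat_into \<A> k)" for n
  have A: "openin Z (A n) \<and> z \<in> A n" for n
    unfolding A_def using from_nat_into[OF neA] V \<B>(2)
    by (intro conjI openin_Int openin_INT2) (auto simp: \<A>_def)
  have "\<exists>y. y \<in> A n \<and> e \<le> \<bar>LINT t|unit_lebesgue. F y t\<bar>" for n
  proof -
    have "\<not> (\<forall>y\<in>A n. \<bar>LINT t|unit_lebesgue. F y t\<bar> < e)" using neg A[of n] by blast
    then show ?thesis by (auto simp: not_less)
  qed
  then obtain y where y: "\<And>n. y n \<in> A n" "\<And>n. e \<le> \<bar>LINT t|unit_lebesgue. F (y n) t\<bar>" by metis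
  have ev: "\<exists>m. \<forall>n\<ge>m. y n \<in> W" if W: "openin Z W" "z \<in> W" for W
  proof -
    obtain W' where W': "W' \<in> \<A>" "W' \<subseteq> W" using \<B>(3)[OF W] by (auto simp: \<A>_def)
    obtain m where m: "from_nat_into \<A> m = W'" using from_nat_into_surj[OF cA W'(1)] by blast
    have "y n \<in> W" if "n \<ge> m" for n using y(1)[of n] that m W'(2) by (auto simp: A_def)
    then show ?thesis by blast
  qed
  have yV: "y n \<in> V" for n using y(1)[of n] by (simp add: A_def)
  interpret finite_measure unit_lebesgue by (rule finite_measure_unit_lebesgue)
  have "(\<lambda>n. LINT t|unit_lebesgue. F (y n) t) \<longlonglongrightarrow> (LINT t|unit_lebesgue. 0)"
  proof (rule integral_dominated_convergence[where w = "\<lambda>_. B"])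
    show "AE t in unit_lebesgue. (\<lambda>n. F (y n) t) \<longlonglongrightarrow> 0"
      using lim
    proof eventually_elim
      case (elim t)
      show ?case
      proof (rule LIMSEQ_I)
        fix r :: real assume "0 < r"
        then obtain W where "openin Z W" "z \<in> W" "\<forall>y\<in>W. \<bar>F y t\<bar> < r" using elim by blast
        then show "\<exists>m. \<forall>n\<ge>m. norm (F (y n) t - 0) < r" using ev[of W] by (simp, blast)
      qed
    qed
    show "AE t in unit_lebesgue. norm (F (y n) t) \<le> B" for n
      by (rule AE_I2) (use bound[OF yV] in simp)
  qed (use meas[OF yV] in auto)
  then have "\<forall>\<^sub>F n in sequentially. \<bar>LINT t|unit_lebesgue. F (y n) t\<bar> < e"
    using e by (auto simp: tendsto_iff dist_real_def)
  then show False using y(2) by (auto simp: eventually_sequentially not_less[symmetric])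
qed

section \<open>Gluing local trivializations along a partition of the unit interval\<close>

text \<open>The total space of \<open>C\<close> carries no topology here, so continuity of
  \<open>\<psi> n\<close> is expressed by its action on continuous sections. The target
  \<open>X\<close> is common to all \<open>n\<close>, which allows different indices for different
  \<open>t\<close>.\<close>

locale trivializing_cover =
  fixes C :: "('z, 'a) metric_field" and X :: "'a metric"
    and U :: "nat \<Rightarrow> 'z set" and f :: "nat \<Rightarrow> 'z \<Rightarrow> real" and \<psi> :: "nat \<Rightarrow> 'z \<Rightarrow> 'a \<Rightarrow> 'a"
  assumes C: "continuous_field C" and sc: "second_countable_field C"
    and scX: "second_countable (mtopology_of X)"
    and U: "openin (base C) (U n)"
    and \<psi>_iso: "y \<in> U n \<Longrightarrow> isometric_bij (fiber C y) X (\<psi> n y)"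
    and \<psi>_cont: "u \<in> cont_sections C \<Longrightarrow>
      continuous_map (subtopology (base C) (U n)) (mtopology_of X) (\<lambda>y. \<psi> n y (u y))"
    and f: "continuous_map (base C) euclideanreal (f n)"
    and f_U: "\<lbrakk>z \<in> topspace (base C); 0 \<le> f n z\<rbrakk> \<Longrightarrow> z \<in> U n"
    and f_cover: "z \<in> topspace (base C) \<Longrightarrow> \<exists>n. 1 < f n z"
begin

text \<open>Index \<open>n\<close> is used on the interval from the maximum of \<open>0\<close> and all \<open>f k z\<close> with \<open>k < n\<close> to
  \<open>f n z\<close>, whose endpoints depend continuously on \<open>z\<close>.\<close>

definition index :: "'z \<Rightarrow> real \<Rightarrow> nat" where
  "index z t = (LEAST n. t < f n z)"

lemma
  assumes "z \<in> topspace (base C)" "t \<in> {0..1}"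
  shows index_less: "t < f (index z t) z" and index_U: "z \<in> U (index z t)"
proof -
  obtain k where "1 < f k z" using f_cover[OF assms(1)] by blast
  then have "\<exists>n. t < f n z" using assms(2) by (intro exI[of _ k]) simp
  then show *: "t < f (index z t) z" unfolding index_def by (rule LeastI_ex)
  then show "z \<in> U (index z t)" using assms by (intro f_U) auto
qed

lemma index_le: "t < f k z \<Longrightarrow> index z t \<le> k"
  unfolding index_def by (rule Least_le)

lemma U_topspace: "y \<in> U n \<Longrightarrow> y \<in> topspace (base C)"
  using openin_subset[OF U] by blast

lemma f_open: "openin (base C) {z \<in> topspace (base C). f n z \<in> S}" if "open S"
  by (rule openin_continuous_map_preimage[OF f]) (use that in simp)

lemma piecewise_isometry_index:
  assumes z: "z \<in> topspace (base C)"
  shows "piecewise_isometry (fiber C z) X (\<lambda>n. \<psi> n z) (index z)"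
proof
  show "second_countable (mtopology_of (fiber C z))" by (rule second_countable_fiber[OF sc z])
  show "second_countable (mtopology_of X)" by (rule scX)
  have [measurable]: "(\<lambda>t::real. t) \<in> borel_measurable unit_lebesgue"
    by (rule continuous_imp_measurable_on_sets_lebesgue) auto
  show "index z \<in> measurable unit_lebesgue (count_space UNIV)"
    unfolding index_def by measurable
  obtain k where "1 < f k z" using f_cover[OF z] by blast
  then have "index z t \<le> k" if "t \<in> {0..1}" for t using that by (intro index_le) simp
  then have "index z ` {0..1} \<subseteq> {..k}" by blast
  then show "finite (index z ` {0..1})" by (rule finite_subset) simp
  show "isometric_bij (fiber C z) X (\<psi> (index z t) z)" if "t \<in> {0..1}" for t
    by (rule \<psi>_iso[OF index_U[OF z that]])
qed

lemma \<psi>_near: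
  assumes u: "u \<in> cont_sections C" and z: "z \<in> U n" and e: "0 < e"
  obtains W where "openin (base C) W" "z \<in> W" "W \<subseteq> U n"
    "\<And>y. y \<in> W \<Longrightarrow> mdist X (\<psi> n z (u z)) (\<psi> n y (u y)) < e"
proof -
  have "z \<in> topspace (subtopology (base C) (U n))" using z U_topspace by simp
  then obtain W where W: "openin (subtopology (base C) (U n)) W" "z \<in> W"
    "\<And>y. y \<in> W \<Longrightarrow> mdist X (\<psi> n z (u z)) (\<psi> n y (u y)) < e"
    by (rule continuous_map_mtopology_ofD[OF \<psi>_cont[OF u] _ e]) (rule that)
  have "openin (base C) W" "W \<subseteq> U n" using W(1) by (auto simp: openin_open_subtopology[OF U])
  then show thesis using W that by blast
qed

section \<open>The glued image of a path of sections: local bounds and continuity\<close>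

abbreviation glue :: "('z \<times> real \<Rightarrow> 'a) \<Rightarrow> 'z \<Rightarrow> real \<Rightarrow> 'a" where
  "glue s z t \<equiv> \<psi> (index z t) z (s (z, t))"

lemma glue_L2:
  "\<lbrakk>s \<in> path_sections C; z \<in> topspace (base C)\<rbrakk> \<Longrightarrow> glue s z \<in> L2_functions X"
  by (rule piecewise_isometry.L2_function[OF piecewise_isometry_index path_section_L2[OF C sc]])

text \<open>The distance is continuous on the product of a compact neighborhood of \<open>z\<close>
  with the unit interval, so one bound serves all \<open>t\<close>.\<close>

lemma path_section_locally_bounded:
  assumes s: "s \<in> path_sections C" and u: "u \<in> cont_sections C" and z: "z \<in> topspace (base C)"
  obtains V M where "openin (base C) V" "z \<in> V"
    "\<And>y t. \<lbrakk>y \<in> V; t \<in> {0..1}\<rbrakk> \<Longrightarrow> mdist (fiber C y) (s (y, t)) (u y) \<le> M"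
proof -
  have "locally_compact_space (base C)" using C unfolding continuous_field_def by blast
  then obtain V K where VK: "openin (base C) V" "compactin (base C) K" "z \<in> V" "V \<subseteq> K"
    using z unfolding locally_compact_space_def by blast
  let ?d = "\<lambda>(y, t). mdist (fiber C y) (s (y, t)) (u y)"
  let ?Y = "prod_topology (base C) (top_of_set {0..1::real})"
  have "compactin ?Y (K \<times> {0..1})"
    unfolding compactin_Times using VK(2) by (simp add: compactin_subtopology)
  moreover have "continuous_map ?Y euclideanreal ?d"
    using s u unfolding path_sections_iff[OF C] by blast
  ultimately have "compactin euclideanreal (?d ` (K \<times> {0..1}))" by (rule image_compactin)
  then have "bounded (?d ` (K \<times> {0..1}))" by (simp add: compact_imp_bounded)
  then obtain M where M: "\<And>a. a \<in> ?d ` (K \<times> {0..1}) \<Longrightarrow> \<bar>a\<bar> \<le> M" unfolding bounded_real by blast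
  have "mdist (fiber C y) (s (y, t)) (u y) \<le> M" if "y \<in> V" "t \<in> {0..1}" for y t
    using M[of "mdist (fiber C y) (s (y, t)) (u y)"] that VK(4) by (force simp: image_iff)
  then show thesis using that VK(1,3) by blast
qed

text \<open>Where \<open>f k y > 1\<close>, all indices are at most \<open>k\<close>. For each such
  index \<open>n\<close> the glued value is within \<open>M\<close> of
  \<open>\<psi> n y (u y)\<close> with one reference section \<open>u\<close>, so it is enough to
  bound these finitely many functions near \<open>z\<close> where \<open>f n\<close> is
  nonnegative.\<close>

lemma glue_locally_bounded:
  assumes s: "s \<in> path_sections C" and z: "z \<in> topspace (base C)" and x: "x \<in> mspace X"
  obtains V B where "openin (base C) V" "z \<in> V"
    "\<And>y t. \<lbrakk>y \<in> V; t \<in> {0..1}\<rbrakk> \<Longrightarrow> mdist X (glue s y t) x \<le> B"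
proof -
  obtain a where "a \<in> mspace (fiber C z)" using field_nonempty[OF C z] by blast
  then obtain u where u: "u \<in> cont_sections C" by (rule field_dense[OF C z _ zero_less_one])
  obtain V1 M where V1: "openin (base C) V1" "z \<in> V1"
    "\<And>y t. \<lbrakk>y \<in> V1; t \<in> {0..1}\<rbrakk> \<Longrightarrow> mdist (fiber C y) (s (y, t)) (u y) \<le> M"
    using path_section_locally_bounded[OF s u z] by blast
  obtain k where k: "1 < f k z" using f_cover[OF z] by blast
  \<comment> \<open>If \<open>f n z < 0\<close>, then \<open>f n\<close> is negative near
    \<open>z\<close> and the bound is vacuous. Otherwise \<open>z\<close> itself lies in
    \<open>U n\<close>, and continuity of \<open>\<psi> n\<close> along \<open>u\<close> at
    \<open>z\<close> applies.\<close>
  have "\<exists>W b. openin (base C) W \<and> z \<in> W \<and> (\<forall>y\<in>W. 0 \<le> f n y \<longrightarrow> mdist X (\<psi> n y (u y)) x \<le> b)" for n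
  proof (cases "f n z < 0")
    case True
    then show ?thesis
      using f_open[of "{..<0}" n] z
      by (intro exI[of _ "{z \<in> topspace (base C). f n z \<in> {..<0}}"] exI[of _ 0]) auto
  next
    case False
    then have zU: "z \<in> U n" using f_U[OF z] by simp
    obtain W where W: "openin (base C) W" "z \<in> W" "W \<subseteq> U n"
      "\<And>y. y \<in> W \<Longrightarrow> mdist X (\<psi> n z (u z)) (\<psi> n y (u y)) < 1"
      by (rule \<psi>_near[OF u zU zero_less_one]) blast
    have "mdist X (\<psi> n y (u y)) x \<le> 1 + mdist X (\<psi> n z (u z)) x" if y: "y \<in> W" for y
    proof -
      have mem: "\<psi> n w (u w) \<in> mspace X" if "w \<in> U n" for w
        by (rule isometric_bij_mem[OF \<psi>_iso[OF that] field_section_mem[OF C u U_topspace[OF that]]])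
      have "y \<in> U n" using y W(3) by blast
      from mdist_triangle[OF mem[OF this] mem[OF zU] x] W(4)[OF y] show ?thesis
        by (simp add: mdist_commute[of X "\<psi> n y (u y)"])
    qed
    then show ?thesis using W(1,2) by blast
  qed
  then obtain W b where W: "\<And>n. openin (base C) (W n)" "\<And>n. z \<in> W n"
    "\<And>n y. \<lbrakk>y \<in> W n; 0 \<le> f n y\<rbrakk> \<Longrightarrow> mdist X (\<psi> n y (u y)) x \<le> b n" by metis
  let ?V0 = "{y \<in> topspace (base C). f k y \<in> {1<..}}"
  show thesis
  proof (rule that[of "V1 \<inter> ?V0 \<inter> (\<Inter>n\<le>k. W n)" "M + Max (b ` {..k})"])
    show "openin (base C) (V1 \<inter> ?V0 \<inter> (\<Inter>n\<le>k. W n))"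
      using V1(1) W(1) f_open[of "{1<..}" k] by (intro openin_Int openin_INT2) auto
    show "z \<in> V1 \<inter> ?V0 \<inter> (\<Inter>n\<le>k. W n)" using V1(2) W(2) k z by auto
    fix y t assume y: "y \<in> V1 \<inter> ?V0 \<inter> (\<Inter>n\<le>k. W n)" and t: "t \<in> {0..1::real}"
    define n where "n = index y t"
    have yZ: "y \<in> topspace (base C)" using y by blast
    have n: "n \<le> k" "0 \<le> f n y" "y \<in> U n"
      using y t index_less[OF yZ t] index_U[OF yZ t] by (auto simp: n_def intro!: index_le)
    note sm = path_section_mem[OF C s yZ t] and um = field_section_mem[OF C u yZ]
    have "mdist X (glue s y t) x \<le> mdist X (\<psi> n y (s (y, t))) (\<psi> n y (u y)) + mdist X (\<psi> n y (u y)) x"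
      unfolding n_def[symmetric]
      by (intro mdist_triangle isometric_bij_mem[OF \<psi>_iso[OF n(3)]] sm um x)
    also have "mdist X (\<psi> n y (s (y, t))) (\<psi> n y (u y)) \<le> M"
      using V1(3)[of y t] y t isometric_bij_dist[OF \<psi>_iso[OF n(3)] sm um] by auto
    also have "mdist X (\<psi> n y (u y)) x \<le> b n" using W(3)[of y n] y n(1,2) by blast
    also have "b n \<le> Max (b ` {..k})" using n(1) by (intro Max_ge) auto
    finally show "mdist X (glue s y t) x \<le> M + Max (b ` {..k})" by simp
  qed
qed

text \<open>As \<open>t\<close> is none of the values \<open>f j z\<close>, the finitely many
  inequalities that single out the index at \<open>z\<close> are strict and persist near
  \<open>z\<close>. There the index is constant, and a single trivialization is applied to the slice
  of \<open>s\<close> at \<open>t\<close>.\<close>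

lemma glue_pointwise_continuous:
  assumes s: "s \<in> path_sections C" and z: "z \<in> topspace (base C)" and t: "t \<in> {0..1}"
    and tf: "t \<notin> range (\<lambda>n. f n z)" and e: "0 < e"
  obtains W where "openin (base C) W" "z \<in> W" "\<And>y. y \<in> W \<Longrightarrow> mdist X (glue s z t) (glue s y t) < e"
proof -
  define n where "n = index z t"
  have nz: "t < f n z" "z \<in> U n" using index_less[OF z t] index_U[OF z t] by (auto simp: n_def)
  let ?u = "\<lambda>z\<in>topspace (base C). s (z, t)"
  obtain W where W: "openin (base C) W" "z \<in> W" "W \<subseteq> U n"
    "\<And>y. y \<in> W \<Longrightarrow> mdist X (\<psi> n z (?u z)) (\<psi> n y (?u y)) < e"
    by (rule \<psi>_near[OF path_section_slice[OF C s t] nz(2) e]) blast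
  have small: "f j z < t" if "j < n" for j
  proof -
    have "\<not> t < f j z" using not_less_Least[of j "\<lambda>n. t < f n z"] that by (simp add: n_def index_def)
    then show ?thesis using tf by (metis linorder_neqE_linordered_idom rangeI)
  qed
  let ?V = "\<lambda>n S. {y \<in> topspace (base C). f n y \<in> S}"
  let ?W = "W \<inter> ?V n {t<..} \<inter> (W \<inter> (\<Inter>j<n. ?V j {..<t}))"
  have "openin (base C) (W \<inter> (\<Inter>j<n. ?V j {..<t}))"
  proof (cases "n = 0")
    case False
    then show ?thesis using W(1) f_open[of "{..<t}"] by (intro openin_Int openin_INT2) auto
  qed (use W(1) in simp)
  then have "openin (base C) ?W" by (intro openin_Int[OF openin_Int[OF W(1) f_open]]) simp_all
  moreover have "z \<in> ?W" using W(2) nz z small by auto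
  moreover have "mdist X (glue s z t) (glue s y t) < e" if y: "y \<in> ?W" for y
  proof -
    have "index y t = n"
      unfolding index_def using y
      by (intro Least_equality) (auto simp: not_less[symmetric] dest: less_asym)
    then show ?thesis using W(4)[of y] y z by (simp add: n_def)
  qed
  ultimately show thesis using that by blast
qed

lemma glue_continuous:
  assumes s: "s \<in> path_sections C" and z: "z \<in> topspace (base C)" and e: "0 < e"
  obtains W where "openin (base C) W" "z \<in> W"
    "\<And>y. y \<in> W \<Longrightarrow> L2_dist X (glue s z) (glue s y) < e"
proof -
  have zX: "glue s z t \<in> mspace X" if "t \<in> {0..1}" for t
    by (rule isometric_bij_mem[OF \<psi>_iso[OF index_U[OF z that]] path_section_mem[OF C s z that]])
  define x where "x = glue s z 0"
  have x: "x \<in> mspace X" using zX[of 0] by (simp add: x_def)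
  obtain V B where V: "openin (base C) V" "z \<in> V"
    "\<And>y t. \<lbrakk>y \<in> V; t \<in> {0..1}\<rbrakk> \<Longrightarrow> mdist X (glue s y t) x \<le> B"
    by (rule glue_locally_bounded[OF s z x]) blast
  let ?F = "\<lambda>y t. (mdist X (glue s z t) (glue s y t))\<^sup>2"
  have VZ: "y \<in> topspace (base C)" if "y \<in> V" for y using openin_subset[OF V(1)] that by blast
  have "\<exists>W. openin (base C) W \<and> z \<in> W \<and> (\<forall>y\<in>W. \<bar>LINT t|unit_lebesgue. ?F y t\<bar> < e\<^sup>2)"
  proof (rule integral_dominated_convergence_first_countable[OF _ V(1,2)])
    show "first_countable (base C)"
      using sc by (simp add: second_countable_field_def second_countable_imp_first_countable)
    fix y assume y: "y \<in> V"
    show "?F y \<in> borel_measurable unit_lebesgue"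
      by (rule borel_measurable_integrable[OF integrable_mdist_L2[OF scX glue_L2[OF s z]
            glue_L2[OF s VZ[OF y]]]])
    fix t :: real assume t: "t \<in> {0..1}"
    have "glue s y t \<in> mspace X"
      by (rule isometric_bij_mem[OF \<psi>_iso[OF index_U[OF VZ[OF y] t]] path_section_mem[OF C s VZ[OF y] t]])
    from mdist_triangle[OF zX[OF t] x this]
    have "mdist X (glue s z t) (glue s y t) \<le> 2 * B"
      using V(3)[OF V(2) t] V(3)[OF y t] by (simp add: mdist_commute[of X x])
    then show "\<bar>?F y t\<bar> \<le> (2 * B)\<^sup>2" using power_mono[OF _ mdist_nonneg, of X _ _ "2 * B" 2] by simp
  next
    \<comment> \<open>Only at these countably many \<open>t\<close> can the index change arbitrarily
      close to \<open>z\<close>.\<close>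
    have "negligible (range (\<lambda>n. f n z))"
      by (simp add: negligible_iff_null_sets null_sets_completionI countable_imp_null_set_lborel)
    then have "AE t in unit_lebesgue. t \<notin> range (\<lambda>n. f n z)"
      by (rule AE_unit_lebesgue_negligible)
    then show "AE t in unit_lebesgue. \<forall>e>0. \<exists>W. openin (base C) W \<and> z \<in> W \<and> (\<forall>y\<in>W. \<bar>?F y t\<bar> < e)"
    proof (rule AE_mp, intro AE_I2 impI allI)
      fix t e :: real assume t: "t \<in> space unit_lebesgue" "t \<notin> range (\<lambda>n. f n z)" and e: "0 < e"
      obtain W where W: "openin (base C) W" "z \<in> W"
        "\<And>y. y \<in> W \<Longrightarrow> mdist X (glue s z t) (glue s y t) < sqrt e"
        by (rule glue_pointwise_continuous[OF s z _ t(2), of "sqrt e"]) (use t e in auto)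
      have "\<bar>?F y t\<bar> < e" if "y \<in> W" for y
        using power_strict_mono[OF W(3)[OF that], of 2] e by simp
      then show "\<exists>W. openin (base C) W \<and> z \<in> W \<and> (\<forall>y\<in>W. \<bar>?F y t\<bar> < e)" using W by blast
    qed
  qed (use e in simp)
  then obtain W where W: "openin (base C) W" "z \<in> W" "\<And>y. y \<in> W \<Longrightarrow> \<bar>LINT t|unit_lebesgue. ?F y t\<bar> < e\<^sup>2"
    by blast
  have "L2_dist X (glue s z) (glue s y) < e" if "y \<in> W" for y
    unfolding L2_dist_def using W(3)[OF that] e by (intro real_less_lsqrt) auto
  then show thesis using W that by blast
qed

text \<open>A path section \<open>s\<close> close to \<open>\<sigma>\<close> at \<open>z\<close>
  stays close near \<open>z\<close>, since \<open>\<sigma>\<close> is co-continuous with the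
  generators. The fiberwise maps preserve this closeness, being isometries, and the image of
  \<open>s\<close> is already known to vary continuously.\<close>

lemma glued_section_continuous:
  assumes \<sigma>: "\<sigma> \<in> cont_sections (randomization C)"
  shows "continuous_map (base C) (mtopology_of (L2_space X))
    (\<lambda>z. L2_map X (\<lambda>t. \<psi> (index z t) z) (\<sigma> z))"
  unfolding continuous_map_mtopology_of_iff
proof (intro conjI ballI allI impI)
  let ?\<Phi> = "\<lambda>z. L2_map X (\<lambda>t. \<psi> (index z t) z)"
  note iso = piecewise_isometry.isometric_bij_L2_map[OF piecewise_isometry_index]
  note \<sigma>m = randomization_section_mem[OF C sc \<sigma>]
  show mem: "(\<lambda>z. ?\<Phi> z (\<sigma> z)) \<in> topspace (base C) \<rightarrow> mspace (L2_space X)"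
    by (intro funcsetI isometric_bij_mem[OF iso] \<sigma>m)
  fix z and e :: real assume z: "z \<in> topspace (base C)" and e: "0 < e"
  let ?c = "\<lambda>s z. ae_equal (fiber C z) `` {\<lambda>t. s (z, t)}"
  obtain \<xi> where \<xi>: "\<xi> \<in> L2_functions (fiber C z)" "\<sigma> z = ae_equal (fiber C z) `` {\<xi>}"
    by (rule L2_space_cases[OF second_countable_fiber[OF sc z] \<sigma>m[OF z]])
  have e3: "0 < e / 3" using e by simp
  obtain s where s: "s \<in> path_sections C" "L2_dist (fiber C z) \<xi> (\<lambda>t. s (z, t)) < e / 3"
    by (rule path_sections_dense[OF C sc z \<xi>(1) e3])
  let ?d = "\<lambda>y. mdist (L2_space (fiber C y)) (\<sigma> y) (?c s y)"
  have dz: "?d z < e / 3"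
    unfolding \<xi>(2) mdist_L2_space[OF second_countable_fiber[OF sc z] \<xi>(1) path_section_L2[OF C sc s(1) z]]
    by (rule s(2))
  \<comment> \<open>The margin left at \<open>z\<close>, so that \<open>?d y < e / 3\<close> on all
    of \<open>W1\<close>.\<close>
  have "0 < e / 3 - ?d z" using dz by simp
  then obtain W1 where W1: "openin (base C) W1" "z \<in> W1" "\<And>y. y \<in> W1 \<Longrightarrow> \<bar>?d z - ?d y\<bar> < e / 3 - ?d z"
    by (rule continuous_map_euclideanrealD[OF randomization_section_continuous[OF C sc \<sigma> s(1)] z]) (rule that)
  obtain W2 where W2: "openin (base C) W2" "z \<in> W2" "\<And>y. y \<in> W2 \<Longrightarrow> L2_dist X (glue s z) (glue s y) < e / 3"
    by (rule glue_continuous[OF s(1) z e3]) blast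
  have cm: "?c s y \<in> mspace (L2_space (fiber C y))" and \<Phi>c: "?\<Phi> y (?c s y) = ae_equal X `` {glue s y}"
    if y: "y \<in> topspace (base C)" for y
    using L2_class_mem[OF second_countable_fiber[OF sc y] path_section_L2[OF C sc s(1) y]]
      piecewise_isometry.L2_map_class[OF piecewise_isometry_index[OF y] path_section_L2[OF C sc s(1) y]]
    by auto
  have \<Phi>cm: "?\<Phi> y (?c s y) \<in> mspace (L2_space X)" if "y \<in> topspace (base C)" for y
    by (rule isometric_bij_mem[OF iso[OF that] cm[OF that]])
  have \<Phi>\<sigma>m: "?\<Phi> y (\<sigma> y) \<in> mspace (L2_space X)" if "y \<in> topspace (base C)" for y
    by (rule isometric_bij_mem[OF iso[OF that] \<sigma>m[OF that]])
  have close: "mdist (L2_space X) (?\<Phi> y (\<sigma> y)) (?\<Phi> y (?c s y)) = ?d y" if "y \<in> topspace (base C)" for y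
    by (rule isometric_bij_dist[OF iso[OF that] \<sigma>m[OF that] cm[OF that]])
  have "mdist (L2_space X) (?\<Phi> z (\<sigma> z)) (?\<Phi> y (\<sigma> y)) < e" if y: "y \<in> W1 \<inter> W2" for y
  proof -
    have yZ: "y \<in> topspace (base C)" using openin_subset[OF W1(1)] y by blast
    have "?d y < e / 3" using W1(3)[of y] y by (auto simp: abs_less_iff)
    moreover have "mdist (L2_space X) (?\<Phi> z (?c s z)) (?\<Phi> y (?c s y)) < e / 3"
      unfolding \<Phi>c[OF z] \<Phi>c[OF yZ] mdist_L2_space[OF scX glue_L2[OF s(1) z] glue_L2[OF s(1) yZ]]
      using W2(3) y by blast
    ultimately show ?thesis
      using mdist_triangle[OF \<Phi>\<sigma>m[OF z] \<Phi>cm[OF z] \<Phi>\<sigma>m[OF yZ]]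
        mdist_triangle[OF \<Phi>cm[OF z] \<Phi>cm[OF yZ] \<Phi>\<sigma>m[OF yZ]]
        close[OF z] close[OF yZ] dz
        mdist_commute[of "L2_space X" "?\<Phi> y (\<sigma> y)" "?\<Phi> y (?c s y)"] by linarith
  qed
  then show "\<exists>W. openin (base C) W \<and> z \<in> W \<and>
      (\<forall>y\<in>W. mdist (L2_space X) (?\<Phi> z (\<sigma> z)) (?\<Phi> y (\<sigma> y)) < e)"
    using W1(1,2) W2(1,2) by (intro exI[of _ "W1 \<inter> W2"]) auto
qed

lemma trivial_randomization: "trivial_field (randomization C)"
proof -
  let ?\<Phi> = "\<lambda>z. L2_map X (\<lambda>t. \<psi> (index z t) z)"
  let ?D = "constant_field (base C) (L2_space X)"
  note iso = piecewise_isometry.isometric_bij_L2_map[OF piecewise_isometry_index]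
  have "isometric_field_iso (randomization C) ?D (\<lambda>z. z) ?\<Phi>"
    unfolding isometric_field_iso_def
  proof (intro conjI ballI)
    show "homeomorphic_map (base ?D) (base (randomization C)) (\<lambda>z. z)"
      using homeomorphic_map_id[of "base C" "base C"]
      by (simp add: constant_field_def base_randomization[OF C sc] id_def)
    show "isometric_bij (fiber (randomization C) y) (fiber ?D y) (?\<Phi> y)" if "y \<in> topspace (base ?D)" for y
      using iso[of y] that by (simp add: constant_field_def fiber_randomization[OF C sc])
    fix \<sigma> assume \<sigma>: "\<sigma> \<in> cont_sections (randomization C)"
    have "continuous_map (base C) (mtopology_of (L2_space X)) (\<lambda>z\<in>topspace (base C). ?\<Phi> z (\<sigma> z))"
      using glued_section_continuous[OF \<sigma>] by (rule continuous_map_eq) simp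
    moreover have "?\<Phi> z (\<sigma> z) \<in> mspace (L2_space X)" if "z \<in> topspace (base C)" for z
      by (rule isometric_bij_mem[OF iso[OF that] randomization_section_mem[OF C sc \<sigma> that]])
    ultimately show "(\<lambda>y\<in>topspace (base ?D). ?\<Phi> y (\<sigma> y)) \<in> cont_sections ?D"
      by (simp add: constant_field_def all_sections_def restrict_PiE_iff)
  qed
  then show ?thesis unfolding trivial_field_def by blast
qed

end

theorem corollary8p9:
  fixes C :: "('z, 'a) metric_field" and X :: "'b metric"
  assumes "continuous_field C"
    and "second_countable_field C"
    and "locally_trivial_field C"
    and "hilbert_hadamard X"
    and "\<forall>z\<in>topspace (base C). \<exists>f. isometric_bij (fiber C z) X f"
  shows "trivial_field (randomization C)"
proof (cases "topspace (base C) = {}")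
  case True
  \<comment> \<open>Over an empty base there is no fiber to serve as model, but all conditions on
    fibers are vacuous and any \<open>Y\<close> of the right type works.\<close>
  have "isometric_field_iso (randomization C) (constant_field (base C) Y) (\<lambda>z. z) \<phi>"
    for Y :: "(real \<Rightarrow> 'a) set metric" and \<phi>
    unfolding isometric_field_iso_def
    using True homeomorphic_map_id[of "base C" "base C"]
    by (auto simp: constant_field_def base_randomization[OF assms(1,2)] all_sections_def id_def
        continuous_map_on_empty)
  then show ?thesis unfolding trivial_field_def by blast
next
  case False
  let ?Z = "base C"
  obtain z0 where z0: "z0 \<in> topspace ?Z" using False by blast
  \<comment> \<open>A fiber is the model because \<open>X\<close> lives over \<open>'b\<close>,
    whereas \<open>trivial_field\<close> asks for a constant fiber over the type of the
    field.\<close>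
  let ?X = "fiber C z0"
  define triv where "triv V \<psi> \<longleftrightarrow> openin ?Z V \<and> (\<forall>y\<in>V. isometric_bij (fiber C y) ?X (\<psi> y)) \<and>
    (\<forall>u\<in>cont_sections C. continuous_map (subtopology ?Z V) (mtopology_of ?X) (\<lambda>y. \<psi> y (u y)))" for V \<psi>
  have "\<exists>V \<psi>. x \<in> V \<and> triv V \<psi>" if x: "x \<in> topspace ?Z" for x
  proof -
    have "\<exists>f. isometric_bij (fiber C z) X f" if "z \<in> topspace ?Z" for z using assms(5) that by blast
    then obtain V \<psi> where "openin ?Z V" "x \<in> V" "\<And>y. y \<in> V \<Longrightarrow> isometric_bij (fiber C y) ?X (\<psi> y)"
      "\<And>u. u \<in> cont_sections C \<Longrightarrow> continuous_map (subtopology ?Z V) (mtopology_of ?X) (\<lambda>y. \<psi> y (u y))"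
      by (rule local_trivialization[OF assms(1,3) _ z0 x]) (assumption | rule that)+
    then show ?thesis unfolding triv_def by (intro exI[of _ V] exI[of _ \<psi>]) simp
  qed
  then obtain V \<psi> where V: "\<And>x. x \<in> topspace ?Z \<Longrightarrow> x \<in> V x \<and> triv (V x) (\<psi> x)" by metis
  have VO: "openin ?Z (V x) \<and> x \<in> V x" if "x \<in> topspace ?Z" for x
    using V[OF that] by (simp add: triv_def)
  have Z: "locally_compact_space ?Z" "Hausdorff_space ?Z" "second_countable ?Z"
    using assms(1,2) unfolding continuous_field_def second_countable_field_def by blast+
  obtain p and f :: "nat \<Rightarrow> 'z \<Rightarrow> real" where p: "\<And>n. p n \<in> topspace ?Z"
    and f: "\<And>n. continuous_map ?Z euclideanreal (f n)"
      "\<And>n z. z \<in> topspace ?Z \<Longrightarrow> 0 \<le> f n z \<Longrightarrow> z \<in> V (p n)"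
      "\<And>z. z \<in> topspace ?Z \<Longrightarrow> \<exists>n. 1 < f n z"
    by (rule countable_cover_functions[OF Z(3,1,2) False VO]) blast+
  have triv: "triv (V (p n)) (\<psi> (p n))" for n using V[OF p] by blast
  interpret trivializing_cover C ?X "\<lambda>n. V (p n)" f "\<lambda>n. \<psi> (p n)"
    using assms(1,2) second_countable_fiber[OF assms(2) z0] triv f
    unfolding triv_def by unfold_locales blast+
  show ?thesis by (rule trivial_randomization)
qed

end
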